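(* Let $1\leq p<\infty$ and let $\{\phi_t\}_{t\geq0}$ be a nontrivial semigroup of analytic self-maps of the unit disc. Then $[\phi_t,BMOA_p]\subsetneq BMOA_p$; that is, there is $f\in BMOA_p$ for which $\|f\circ\phi_t-f\|_{BMOA_p}$ does not tend to $0$ as $t\to0^+$.
   Context: $\mathbb{D}$ is the open unit disc, $H(\mathbb{D})$ the space of analytic functions on $\mathbb{D}$, $dm$ the normalized Lebesgue area measure on $\mathbb{D}$, and $\varphi_a(z)=\frac{a-z}{1-\bar a z}$ for $a\in\mathbb{D}$. For $p\geq 1$, $BMOA_p$ is the Banach space of $f\in H(\mathbb{D})$ with finite norm $$\|f\|_{BMOA_p}^p=|f(0)|^p+\sup_{a\in\mathbb{D}}\int_{\mathbb{D}}|f'(z)|^p(1-|z|^2)^{p-2}(1-|\varphi_a(z)|^2)\,dm(z).$$ A semigroup of functions is a family $\{\phi_t\}_{t\geq0}$ of analytic self-maps of $\mathbb{D}$ such that $\phi_0(z)=z$; $\phi_t\circ\phi_s=\phi_{t+s}$ for all $t,s\geq0$; and $\phi_t\to\phi_0$ uniformly on compact subsets of $\mathbb{D}$ as $t\to0$. It is trivial if $\phi_t(z)=z$ for all $t\ge 0$, and nontrivial otherwise. For a Banach space $X$ of analytic functions on $\mathbb{D}$, $[\phi_t,X]=\{f\in X:\lim_{t\to0^+}\|f\circ\phi_t-f\|_X=0\}$. *)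

theory Defs
  imports "HOL-Analysis.Analysis"
begin

abbreviation unit_disc :: "complex set"  (\<open>\<D>\<close>)
  where "\<D> \<equiv> ball 0 1"

definition area_measure :: "complex measure" where
  "area_measure = scale_measure (ennreal (1 / pi)) (restrict_space lborel \<D>)"

definition disc_aut :: "complex \<Rightarrow> complex \<Rightarrow> complex" where
  "disc_aut a z = (a - z) / (1 - cnj a * z)"

definition ennreal_powr :: "ennreal \<Rightarrow> real \<Rightarrow> ennreal" where
  "ennreal_powr x r = (if x = \<infinity> then \<infinity> else ennreal (enn2real x powr r))"

text \<open>
  The norm takes values in \<open>[0, \<infinity>]\<close>; the value \<open>\<infinity>\<close> says that the function is not in the space.
  In particular, convergence to \<open>0\<close> of \<open>bmoa_norm p (f \<circ> \<phi> t - f)\<close> entails that this difference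
  lies in the space for all small \<open>t\<close>.
\<close>

definition bmoa_norm :: "real \<Rightarrow> (complex \<Rightarrow> complex) \<Rightarrow> ennreal" where
  "bmoa_norm p f =
     ennreal_powr
       (ennreal (norm (f 0) powr p) +
        (SUP a\<in>\<D>. \<integral>\<^sup>+ z. ennreal (norm (deriv f z) powr p * (1 - (norm z)\<^sup>2) powr (p - 2) *
                                  (1 - (norm (disc_aut a z))\<^sup>2)) \<partial>area_measure))
       (1 / p)"

text \<open>
  Functions on the disc are represented by total functions whose values outside the disc are
  irrelevant: every condition below depends on the values on the (open) disc only.
\<close>

definition BMOA :: "real \<Rightarrow> (complex \<Rightarrow> complex) set" where
  "BMOA p = {f. f holomorphic_on \<D> \<and> bmoa_norm p f < \<infinity>}"

definition disc_semigroup :: "(real \<Rightarrow> complex \<Rightarrow> complex) \<Rightarrow> bool" where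
  "disc_semigroup \<phi> \<longleftrightarrow>
     (\<forall>t\<ge>0. \<phi> t holomorphic_on \<D> \<and> \<phi> t ` \<D> \<subseteq> \<D>) \<and>
     (\<forall>z\<in>\<D>. \<phi> 0 z = z) \<and>
     (\<forall>t\<ge>0. \<forall>s\<ge>0. \<forall>z\<in>\<D>. \<phi> t (\<phi> s z) = \<phi> (t + s) z) \<and>
     (\<forall>K. compact K \<and> K \<subseteq> \<D> \<longrightarrow> uniform_limit K \<phi> (\<phi> 0) (at_right 0))"

definition trivial_semigroup :: "(real \<Rightarrow> complex \<Rightarrow> complex) \<Rightarrow> bool" where
  "trivial_semigroup \<phi> \<longleftrightarrow> (\<forall>t\<ge>0. \<forall>z\<in>\<D>. \<phi> t z = z)"

text \<open>The space \<open>[\<phi>\<^sub>t, X]\<close>, where \<open>N\<close> is the norm of \<open>X\<close>.\<close>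

definition strong_cont_space ::
  "(real \<Rightarrow> complex \<Rightarrow> complex) \<Rightarrow> (complex \<Rightarrow> complex) set \<Rightarrow>
   ((complex \<Rightarrow> complex) \<Rightarrow> ennreal) \<Rightarrow> (complex \<Rightarrow> complex) set" where
  "strong_cont_space \<phi> X N =
     {f \<in> X. ((\<lambda>t. N (\<lambda>z. (f \<circ> \<phi> t) z - f z)) \<longlongrightarrow> 0) (at_right 0)}"

end

theory Submission
  imports Defs "HOL-Complex_Analysis.Complex_Analysis"
begin

text \<open>
  A self-map \<open>\<phi>\<close> other than the identity moves some points arbitrarily far in the hyperbolic metric,
  arbitrarily near the circle: otherwise \<open>\<phi>(z) - z\<close> would vanish on the boundary and the maximum
  principle would give \<open>\<phi> = id\<close>. Suppose that \<open>f \<circ> \<phi>\<^sub>t \<rightarrow> f\<close> for all \<open>f\<close> in the space, and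
  sum up (negatives of) automorphisms \<open>\<phi>\<^sub>b\<close>, normalised to vanish at 0, over points \<open>b = b\<^sub>n\<close>
  chosen inductively. First take a time \<open>t\<^sub>n\<close> so small that composition with \<open>\<phi>\<^sub>t\<close> hardly
  changes the partial sum, then \<open>b\<^sub>n\<close> close to the circle and moved far by \<open>\<phi>\<^sub>t\<close>. If the
  \<open>b\<^sub>n\<close> are sparse enough, the sum \<open>f\<close> lies in the space, because \<open>|\<phi>\<^sub>b'|\<close> is the Poisson kernel
  \<open>K\<^sub>b\<close>, \<open>K\<^sub>b(z) (1 - |z|\<^sup>2) = 1 - |\<phi>\<^sub>b(z)|\<^sup>2 \<le> 1\<close>, and \<open>\<integral> K\<^sub>a K\<^sub>b dm\<close> is bounded and tends to 0 when one of the
  points stays in a compact set and the other approaches the circle. By the Schwarz-Pick lemma,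
  the Bloch seminorm of \<open>f \<circ> \<phi>\<^sub>t - f\<close> at \<open>b\<^sub>n\<close>, where \<open>t = t\<^sub>n\<close>, is at least 1/2. As \<open>f\<close> is a Bloch
  function, this bounds the norm of the difference from below, contradicting the convergence.
\<close>

subsection \<open>Poisson kernels and their area pairings\<close>

definition poisson_kernel :: "complex \<Rightarrow> complex \<Rightarrow> real" where
  "poisson_kernel a z = (1 - (norm a)\<^sup>2) / (norm (1 - cnj a * z))\<^sup>2"

definition hyp_prox :: "complex \<Rightarrow> complex \<Rightarrow> real" where
  "hyp_prox a z = 1 - (norm (disc_aut a z))\<^sup>2"

lemma one_minus_norm_le:
  assumes "norm z \<le> 1"
  shows "1 - norm a \<le> norm (1 - cnj a * z)"
proof -
  have "norm (cnj a * z) \<le> norm a"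
    using assms by (simp add: norm_mult mult_left_le)
  then show ?thesis
    using norm_triangle_ineq2[of 1 "cnj a * z"] by simp
qed

lemma one_minus_cnj_mult_nonzero:
  assumes "norm a < 1" "norm z \<le> 1"
  shows "1 - cnj a * z \<noteq> 0"
  using one_minus_norm_le[OF assms(2), of a] assms(1) by auto

lemma one_minus_norm_square_bounds:
  assumes "norm (a::'a::real_normed_vector) < 1"
  shows "0 < 1 - (norm a)\<^sup>2" "1 - (norm a)\<^sup>2 \<le> 1" "1 - (norm a)\<^sup>2 \<le> 2 * (1 - norm a)"
    "1 - norm a \<le> 1 - (norm a)\<^sup>2"
proof -
  show "0 < 1 - (norm a)\<^sup>2"
    using assms by (simp add: abs_square_less_1)
  show "1 - (norm a)\<^sup>2 \<le> 1" by simp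
  have "0 \<le> (1 - norm a)\<^sup>2" by simp
  then show "1 - (norm a)\<^sup>2 \<le> 2 * (1 - norm a)"
    by (simp add: power2_eq_square algebra_simps)
  show "1 - norm a \<le> 1 - (norm a)\<^sup>2"
    using assms by (simp add: power2_eq_square mult_left_le)
qed

lemma norm_one_minus_cnj_mult_square:
  "(norm (1 - cnj a * z))\<^sup>2 = (norm (a - z))\<^sup>2 + (1 - (norm a)\<^sup>2) * (1 - (norm z)\<^sup>2)"
  unfolding cmod_power2 by (simp add: algebra_simps power2_eq_square)

lemma hyp_prox_eq:
  assumes "norm a < 1" "norm z < 1"
  shows "hyp_prox a z = poisson_kernel a z * (1 - (norm z)\<^sup>2)"
proof -
  have "norm (1 - cnj a * z) \<noteq> 0"
    using one_minus_cnj_mult_nonzero[of a z] assms by simp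
  then show ?thesis
    using norm_one_minus_cnj_mult_square[of a z]
    by (simp add: hyp_prox_def poisson_kernel_def disc_aut_def norm_divide power_divide field_simps)
qed

lemma hyp_prox_commute: "hyp_prox a z = hyp_prox z a"
proof -
  have "cnj (1 - cnj a * z) = 1 - cnj z * a" by (simp add: mult.commute)
  then have "norm (1 - cnj a * z) = norm (1 - cnj z * a)"
    by (metis complex_mod_cnj)
  then show ?thesis
    by (simp add: hyp_prox_def disc_aut_def norm_divide norm_minus_commute)
qed

lemma hyp_prox_le_1: "hyp_prox a z \<le> 1"
  by (simp add: hyp_prox_def)

lemma hyp_prox_self: "hyp_prox a a = 1"
  by (simp add: hyp_prox_def disc_aut_def)

lemma poisson_kernel_nonneg:
  assumes "norm a < 1"
  shows "0 \<le> poisson_kernel a z"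
  using one_minus_norm_square_bounds(1)[OF assms] by (simp add: poisson_kernel_def)

lemma hyp_prox_nonneg:
  assumes "norm a < 1" "norm z < 1"
  shows "0 \<le> hyp_prox a z"
  using poisson_kernel_nonneg[OF assms(1), of z] one_minus_norm_square_bounds(1)[OF assms(2)]
  by (simp add: hyp_prox_eq[OF assms])

lemma poisson_kernel_le:
  assumes "norm a < 1" "0 < \<delta>" "\<delta> \<le> norm (1 - cnj a * z)"
  shows "poisson_kernel a z \<le> 2 * (1 - norm a) / \<delta>\<^sup>2"
  unfolding poisson_kernel_def
  using assms one_minus_norm_square_bounds[OF assms(1)]
  by (intro frac_le power_mono) auto

lemma poisson_kernel_le':
  assumes "norm a \<le> r" "r < 1" "norm z \<le> 1"
  shows "poisson_kernel a z \<le> 2 / (1 - r)"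
proof -
  have "poisson_kernel a z \<le> 2 * (1 - norm a) / (1 - norm a)\<^sup>2"
    using assms by (intro poisson_kernel_le one_minus_norm_le) auto
  also have "\<dots> = 2 / (1 - norm a)"
    using assms by (simp add: power2_eq_square divide_simps)
  also have "\<dots> \<le> 2 / (1 - r)"
    using assms by (intro frac_le) auto
  finally show ?thesis .
qed

lemma hyp_prox_le:
  assumes "norm a \<le> r" "r < 1" "norm z < 1"
  shows "hyp_prox a z \<le> 4 * (1 - norm z) / (1 - r)"
proof -
  have "hyp_prox a z \<le> (2 / (1 - r)) * (2 * (1 - norm z))"
    unfolding hyp_prox_eq[OF order.strict_trans1[OF assms(1,2)] assms(3)]
    using assms one_minus_norm_square_bounds[OF assms(3)]
    by (intro mult_mono poisson_kernel_le') auto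
  then show ?thesis by simp
qed

lemma borel_measurable_poisson_kernel [measurable]:
  "poisson_kernel a \<in> borel_measurable borel"
  unfolding poisson_kernel_def by measurable

lemma space_area_measure [simp]: "space area_measure = \<D>"
  by (simp add: area_measure_def space_scale_measure space_restrict_space)

lemma borel_measurable_area_measure:
  "f \<in> borel_measurable borel \<Longrightarrow> f \<in> borel_measurable area_measure"
  by (simp add: area_measure_def measurable_restrict_space1 cong: measurable_cong_sets)

lemma sets_area_measureI:
  assumes "A \<in> sets borel" "A \<subseteq> \<D>"
  shows "A \<in> sets area_measure"
  using assms by (simp add: area_measure_def sets_restrict_space_iff)

lemma emeasure_area_measure:
  assumes "A \<in> sets borel" "A \<subseteq> \<D>"
  shows "emeasure area_measure A = ennreal (1 / pi) * emeasure lborel A"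
  using assms by (simp add: area_measure_def emeasure_restrict_space)

lemma emeasure_lborel_ball_complex:
  assumes "0 \<le> r"
  shows "emeasure lborel (ball (c::complex) r) = ennreal (pi * r\<^sup>2)"
  using assms by (simp add: emeasure_ball unit_ball_vol_2)

lemma emeasure_area_measure_ball:
  assumes "0 \<le> r" "ball c r \<subseteq> \<D>"
  shows "emeasure area_measure (ball c r) = ennreal (r\<^sup>2)"
  using assms by (simp add: emeasure_area_measure emeasure_lborel_ball_complex flip: ennreal_mult)

lemma emeasure_area_measure_near_le:
  assumes a: "norm a < 1" and \<delta>: "0 < \<delta>"
  shows "emeasure area_measure {z \<in> \<D>. norm (1 - cnj a * z) < \<delta>} \<le> ennreal (4 * \<delta>\<^sup>2)"
proof -
  let ?S = "{z \<in> \<D>. norm (1 - cnj a * z) < \<delta>}"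
  have S: "?S \<in> sets borel" by measurable
  consider "norm a < 1/2" "\<delta> \<le> 1/2" | "norm a < 1/2" "1/2 < \<delta>" | "1/2 \<le> norm a" by linarith
  then show ?thesis
  proof cases
    case 1
    have "\<not> norm (1 - cnj a * z) < \<delta>" if "z \<in> \<D>" for z
      using 1 one_minus_norm_le[of z a] that by simp
    then have "?S = {}" by blast
    then show ?thesis by (simp only: emeasure_empty zero_le)
  next
    case 2
    have "emeasure area_measure ?S \<le> emeasure area_measure \<D>"
      by (intro emeasure_mono sets_area_measureI) auto
    also have "\<dots> = ennreal 1"
      using emeasure_area_measure_ball[of 1 0] by simp
    also have "\<dots> \<le> ennreal (4 * \<delta>\<^sup>2)"
    proof (rule ennreal_leI)
      have "(1/2)\<^sup>2 \<le> \<delta>\<^sup>2" using 2 by (intro power_mono) auto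
      then show "1 \<le> 4 * \<delta>\<^sup>2" by (simp add: power2_eq_square)
    qed
    finally show ?thesis .
  next
    case 3
    have "?S \<subseteq> ball (1 / cnj a) (2 * \<delta>)"
    proof
      fix z assume z: "z \<in> ?S"
      have a0: "a \<noteq> 0" using 3 by auto
      have "norm (1 / cnj a - z) * norm a = norm (1 - cnj a * z)"
        using a0 by (metis complex_mod_cnj norm_mult complex_cnj_zero_iff left_diff_distrib
            nonzero_eq_divide_eq mult.commute)
      moreover have "norm (1 / cnj a - z) * (1/2) \<le> norm (1 / cnj a - z) * norm a"
        using 3 by (intro mult_left_mono) auto
      ultimately show "z \<in> ball (1 / cnj a) (2 * \<delta>)"
        using z by (simp add: dist_norm)
    qed
    then have "emeasure lborel ?S \<le> emeasure lborel (ball (1 / cnj a) (2 * \<delta>))"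
      by (intro emeasure_mono) auto
    then have "emeasure area_measure ?S \<le> ennreal (1/pi) * ennreal (pi * (2 * \<delta>)\<^sup>2)"
      using \<delta> S by (subst emeasure_area_measure) (auto simp: emeasure_lborel_ball_complex intro: mult_left_mono)
    also have "\<dots> = ennreal (4 * \<delta>\<^sup>2)"
      by (simp add: power_mult_distrib flip: ennreal_mult)
    finally show ?thesis .
  qed
qed

text \<open>Dyadic decomposition of the disc according to the size of \<open>|1 - cnj a z|\<close>.\<close>

lemma poisson_kernel_square_le_suminf:
  assumes a: "norm a < 1" and z: "norm z < 1"
  defines "d \<equiv> 1 - norm a"
  shows "ennreal ((poisson_kernel a z)\<^sup>2) \<le>
    (\<Sum>k. ennreal (4 / (16 ^ k * d\<^sup>2)) * indicator {z \<in> \<D>. norm (1 - cnj a * z) < 2 ^ Suc k * d} z)"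
    (is "_ \<le> (\<Sum>k. ?f k)")
proof -
  have d: "0 < d" using a by (simp add: d_def)
  define x where "x = norm (1 - cnj a * z)"
  have x: "d \<le> x" using one_minus_norm_le[of z a] z by (simp add: x_def d_def)
  obtain k where k: "2 ^ k * d \<le> x" "x < 2 ^ Suc k * d"
  proof -
    obtain n where "x / d < 2 ^ n"
      using real_arch_pow[of 2 "x / d"] by auto
    then have ex: "\<exists>n. x < 2 ^ n * d" using d by (auto simp: field_simps)
    define m where "m = (LEAST n. x < 2 ^ n * d)"
    have m: "x < 2 ^ m * d" unfolding m_def by (rule LeastI_ex[OF ex])
    have "m \<noteq> 0" using m x by (intro notI) simp
    then obtain k where k: "m = Suc k" using not0_implies_Suc by blast
    have "\<not> x < 2 ^ k * d" using not_less_Least[of k "\<lambda>n. x < 2 ^ n * d"] k by (simp add: m_def)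
    then show ?thesis using that[of k] m k by auto
  qed
  have "poisson_kernel a z \<le> 2 * d / (2 ^ k * d)\<^sup>2"
    unfolding d_def using a d k by (intro poisson_kernel_le) (auto simp: d_def x_def)
  also have "\<dots> = 2 / (4 ^ k * d)"
  proof -
    have "(2 ^ k * d)\<^sup>2 = 4 ^ k * d * d"
      by (simp add: power_mult_distrib power2_eq_square flip: power_mult_distrib)
    then show ?thesis using d by simp
  qed
  finally have "(poisson_kernel a z)\<^sup>2 \<le> (2 / (4 ^ k * d))\<^sup>2"
    using poisson_kernel_nonneg[OF a, of z] by (intro power_mono) auto
  also have "\<dots> = 4 / (16 ^ k * d\<^sup>2)"
  proof -
    have "((4::real) ^ k)\<^sup>2 = 16 ^ k" by (simp add: power2_eq_square flip: power_mult_distrib)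
    then show ?thesis by (simp add: power_divide power_mult_distrib)
  qed
  finally have "ennreal ((poisson_kernel a z)\<^sup>2) \<le> ?f k"
    using k z by (simp add: x_def ennreal_leI)
  also have "\<dots> = sum ?f {k}" by (simp only: sum.insert sum.empty finite.emptyI empty_iff not_False_eq_True add_0_right)
  also have "\<dots> \<le> (\<Sum>k. ?f k)" by (rule sum_le_suminf) auto
  finally show ?thesis .
qed

lemma nn_integral_poisson_kernel_square_le:
  assumes a: "norm a < 1"
  shows "(\<integral>\<^sup>+z. ennreal ((poisson_kernel a z)\<^sup>2) \<partial>area_measure) \<le> 100"
proof -
  define d where "d = 1 - norm a"
  have d: "0 < d" using a by (simp add: d_def)
  let ?S = "\<lambda>k::nat. {z \<in> \<D>. norm (1 - cnj a * z) < 2 ^ Suc k * d}"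
  have S: "?S k \<in> sets area_measure" for k
    by (rule sets_area_measureI) (measurable, auto)
  have "(\<integral>\<^sup>+z. ennreal ((poisson_kernel a z)\<^sup>2) \<partial>area_measure) \<le>
      (\<integral>\<^sup>+z. (\<Sum>k. ennreal (4 / (16 ^ k * d\<^sup>2)) * indicator (?S k) z) \<partial>area_measure)"
    using poisson_kernel_square_le_suminf[OF a] by (intro nn_integral_mono) (simp add: d_def)
  also have "\<dots> = (\<Sum>k. ennreal (4 / (16 ^ k * d\<^sup>2)) * emeasure area_measure (?S k))"
    using S by (subst nn_integral_suminf) (auto simp: nn_integral_cmult)
  also have "\<dots> \<le> (\<Sum>k. ennreal (64 * (1/4) ^ k))"
  proof (intro suminf_le allI summableI)
    fix k :: nat
    have "ennreal (4 / (16 ^ k * d\<^sup>2)) * emeasure area_measure (?S k) \<le>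
        ennreal (4 / (16 ^ k * d\<^sup>2)) * ennreal (4 * (2 ^ Suc k * d)\<^sup>2)"
      using a d by (intro mult_left_mono emeasure_area_measure_near_le) auto
    also have "\<dots> = ennreal (64 * (1/4) ^ k)"
    proof -
      have "((2::real) ^ k)\<^sup>2 = 4 ^ k" by (simp add: power2_eq_square flip: power_mult_distrib)
      moreover have "(16::real) ^ k = 4 ^ k * 4 ^ k" by (simp flip: power_mult_distrib)
      ultimately have "4 / (16 ^ k * d\<^sup>2) * (4 * (2 ^ Suc k * d)\<^sup>2) = 64 * (1/4) ^ k"
        using d by (simp add: power_mult_distrib field_simps power_divide)
      then show ?thesis using d by (simp flip: ennreal_mult)
    qed
    finally show "ennreal (4 / (16 ^ k * d\<^sup>2)) * emeasure area_measure (?S k) \<le> ennreal (64 * (1/4) ^ k)" .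
  qed
  also have "\<dots> = ennreal (\<Sum>k. 64 * (1/4) ^ k)"
    by (rule suminf_ennreal2) (auto intro!: summable_mult summable_geometric)
  also have "(\<Sum>k. 64 * (1/4::real) ^ k) = 64 * (4/3)"
    by (subst suminf_mult) (auto simp: suminf_geometric summable_geometric)
  also have "ennreal (64 * (4/3)) \<le> ennreal 100" by (rule ennreal_leI) simp
  finally show ?thesis by simp
qed

lemma nn_integral_poisson_kernel_le:
  assumes a: "norm a < 1" and \<delta>: "0 < \<delta>"
  shows "(\<integral>\<^sup>+z. ennreal (poisson_kernel a z) \<partial>area_measure) \<le> ennreal (2 * (1 - norm a) / \<delta>\<^sup>2 + 104 * \<delta>)"
proof -
  let ?K = "poisson_kernel a"
  define S where "S = {z \<in> \<D>. norm (1 - cnj a * z) < \<delta>}"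
  let ?c = "2 * (1 - norm a) / \<delta>\<^sup>2"
  note [measurable] = borel_measurable_area_measure[OF borel_measurable_poisson_kernel]
  have S [measurable]: "S \<in> sets area_measure"
    unfolding S_def by (rule sets_area_measureI) (measurable, auto)
  have c: "0 \<le> ?c" using a by simp
  have pw: "ennreal (?K z) \<le> ennreal ?c + (ennreal \<delta> * ennreal ((?K z)\<^sup>2) + ennreal (1/\<delta>) * indicator S z)"
    if z: "z \<in> \<D>" for z
  proof (cases "z \<in> S")
    case True
    have "0 \<le> (\<delta> * ?K z - 1)\<^sup>2 + \<delta> * ?K z"
      using poisson_kernel_nonneg[OF a, of z] \<delta> by simp
    then have "\<delta> * ?K z \<le> \<delta> * (\<delta> * (?K z)\<^sup>2 + 1/\<delta>)"
      using \<delta> by (simp add: power2_eq_square algebra_simps)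
    then have "?K z \<le> ?c + (\<delta> * (?K z)\<^sup>2 + 1/\<delta>)" using \<delta> c by simp
    then have "ennreal (?K z) \<le> ennreal (?c + (\<delta> * (?K z)\<^sup>2 + 1/\<delta>))" by (rule ennreal_leI)
    also have "\<dots> = ennreal ?c + (ennreal \<delta> * ennreal ((?K z)\<^sup>2) + ennreal (1/\<delta>))"
      using \<delta> c by (simp add: ennreal_plus ennreal_mult)
    finally show ?thesis using True by (simp add: indicator_def)
  next
    case False
    then have "ennreal (?K z) \<le> ennreal ?c" using z a \<delta> by (intro ennreal_leI poisson_kernel_le) (auto simp: S_def)
    then show ?thesis by (rule order_trans) simp
  qed
  have "(\<integral>\<^sup>+z. ennreal (?K z) \<partial>area_measure) \<le>
    (\<integral>\<^sup>+z. ennreal ?c + (ennreal \<delta> * ennreal ((?K z)\<^sup>2) + ennreal (1/\<delta>) * indicator S z) \<partial>area_measure)"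
    using pw by (intro nn_integral_mono) simp
  also have "\<dots> = ennreal ?c * emeasure area_measure \<D> +
     (ennreal \<delta> * (\<integral>\<^sup>+z. ennreal ((?K z)\<^sup>2) \<partial>area_measure) + ennreal (1/\<delta>) * emeasure area_measure S)"
    by (subst nn_integral_add, simp, simp, subst nn_integral_add) (simp_all add: nn_integral_cmult)
  also have "\<dots> \<le> ennreal ?c * ennreal 1 + (ennreal \<delta> * ennreal 100 + ennreal (1/\<delta>) * ennreal (4 * \<delta>\<^sup>2))"
    using emeasure_area_measure_ball[of 1 0] nn_integral_poisson_kernel_square_le[OF a]
      emeasure_area_measure_near_le[OF a \<delta>, folded S_def]
    by (intro add_mono mult_left_mono) auto
  also have "\<dots> = ennreal (?c + 104 * \<delta>)"
  proof -
    have "\<delta> * 100 + 1/\<delta> * (4 * \<delta>\<^sup>2) = 104 * \<delta>" using \<delta> by (simp add: power2_eq_square)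
    moreover have "ennreal ?c * ennreal 1 + (ennreal \<delta> * ennreal 100 + ennreal (1/\<delta>) * ennreal (4 * \<delta>\<^sup>2)) =
        ennreal (?c + (\<delta> * 100 + 1/\<delta> * (4 * \<delta>\<^sup>2)))"
      using \<delta> c by (simp del: ennreal_1 ennreal_numeral flip: ennreal_mult ennreal_plus)
    ultimately show ?thesis by simp
  qed
  finally show ?thesis .
qed

definition kernel_pairing :: "complex \<Rightarrow> complex \<Rightarrow> real" where
  "kernel_pairing a b = enn2real (\<integral>\<^sup>+z. ennreal (poisson_kernel a z * poisson_kernel b z) \<partial>area_measure)"

lemma kernel_pairing_commute: "kernel_pairing a b = kernel_pairing b a"
  by (simp add: kernel_pairing_def mult.commute)

lemma nn_integral_kernel_product_le:
  assumes "norm a < 1" "norm b < 1"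
  shows "(\<integral>\<^sup>+z. ennreal (poisson_kernel a z * poisson_kernel b z) \<partial>area_measure) \<le> 200"
proof -
  note [measurable] = borel_measurable_area_measure[OF borel_measurable_poisson_kernel]
  have "poisson_kernel a z * poisson_kernel b z \<le> (poisson_kernel a z)\<^sup>2 + (poisson_kernel b z)\<^sup>2" for z
  proof -
    have "0 \<le> (poisson_kernel a z - poisson_kernel b z)\<^sup>2 + poisson_kernel a z * poisson_kernel b z"
      using assms by (simp add: poisson_kernel_nonneg)
    then show ?thesis by (simp add: power2_eq_square algebra_simps)
  qed
  then have "(\<integral>\<^sup>+z. ennreal (poisson_kernel a z * poisson_kernel b z) \<partial>area_measure) \<le>
     (\<integral>\<^sup>+z. ennreal ((poisson_kernel a z)\<^sup>2) + ennreal ((poisson_kernel b z)\<^sup>2) \<partial>area_measure)"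
    by (intro nn_integral_mono) (simp flip: ennreal_plus)
  also have "\<dots> = (\<integral>\<^sup>+z. ennreal ((poisson_kernel a z)\<^sup>2) \<partial>area_measure) + (\<integral>\<^sup>+z. ennreal ((poisson_kernel b z)\<^sup>2) \<partial>area_measure)"
    by (rule nn_integral_add) auto
  also have "\<dots> \<le> 100 + 100"
    using assms by (intro add_mono nn_integral_poisson_kernel_square_le)
  finally show ?thesis by simp
qed

lemma ennreal_kernel_pairing:
  assumes "norm a < 1" "norm b < 1"
  shows "ennreal (kernel_pairing a b) = (\<integral>\<^sup>+z. ennreal (poisson_kernel a z * poisson_kernel b z) \<partial>area_measure)"
  unfolding kernel_pairing_def
  using nn_integral_kernel_product_le[OF assms] by (intro ennreal_enn2real) (auto simp: top_unique less_top[symmetric])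

lemma kernel_pairing_nonneg: "0 \<le> kernel_pairing a b"
  by (simp add: kernel_pairing_def)

lemma kernel_pairing_le:
  assumes "norm a < 1" "norm b < 1"
  shows "kernel_pairing a b \<le> 200"
proof -
  have "ennreal (kernel_pairing a b) \<le> ennreal 200"
    using nn_integral_kernel_product_le[OF assms] by (simp add: ennreal_kernel_pairing[OF assms])
  then show ?thesis by (subst (asm) ennreal_le_iff) auto
qed

lemma kernel_pairing_decay:
  assumes r: "r < 1" and \<epsilon>: "0 < \<epsilon>"
  obtains s where "s < 1" "\<And>a b. norm a \<le> r \<Longrightarrow> s \<le> norm b \<Longrightarrow> norm b < 1 \<Longrightarrow> kernel_pairing a b \<le> \<epsilon>"
proof -
  note [measurable] = borel_measurable_area_measure[OF borel_measurable_poisson_kernel]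
  define B where "B = 2 / (1 - r)"
  have B: "0 < B" using r by (simp add: B_def)
  define \<delta> where "\<delta> = \<epsilon> / (208 * B)"
  have \<delta>: "0 < \<delta>" using B \<epsilon> by (simp add: \<delta>_def)
  define s where "s = 1 - \<epsilon> * \<delta>\<^sup>2 / (4 * B)"
  show ?thesis
  proof (rule that)
    show "s < 1" using B \<delta> \<epsilon> by (simp add: s_def)
    fix a b :: complex
    assume a: "norm a \<le> r" and b: "s \<le> norm b" "norm b < 1"
    have a1: "norm a < 1" using a r by simp
    have "ennreal (kernel_pairing a b) \<le> (\<integral>\<^sup>+z. ennreal B * ennreal (poisson_kernel b z) \<partial>area_measure)"
      unfolding ennreal_kernel_pairing[OF a1 b(2)]
    proof (rule nn_integral_mono)
      fix z assume "z \<in> space area_measure"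
      then have "poisson_kernel a z * poisson_kernel b z \<le> B * poisson_kernel b z"
        using a r b unfolding B_def by (intro mult_right_mono poisson_kernel_le' poisson_kernel_nonneg) auto
      then show "ennreal (poisson_kernel a z * poisson_kernel b z) \<le> ennreal B * ennreal (poisson_kernel b z)"
        using B b by (simp add: poisson_kernel_nonneg flip: ennreal_mult)
    qed
    also have "\<dots> = ennreal B * (\<integral>\<^sup>+z. ennreal (poisson_kernel b z) \<partial>area_measure)"
      by (rule nn_integral_cmult) simp
    also have "\<dots> \<le> ennreal B * ennreal (2 * (1 - norm b) / \<delta>\<^sup>2 + 104 * \<delta>)"
      using b \<delta> by (intro mult_left_mono nn_integral_poisson_kernel_le) auto
    also have "\<dots> = ennreal (B * (2 * (1 - norm b) / \<delta>\<^sup>2 + 104 * \<delta>))"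
      using B b \<delta> by (intro ennreal_mult[symmetric] add_nonneg_nonneg) auto
    also have "\<dots> \<le> ennreal \<epsilon>"
    proof (rule ennreal_leI)
      have "2 * (1 - norm b) / \<delta>\<^sup>2 \<le> \<epsilon> / (2 * B)"
        using b B \<delta> by (simp add: s_def field_simps)
      moreover have "104 * \<delta> = \<epsilon> / (2 * B)" using B by (simp add: \<delta>_def field_simps)
      ultimately have "2 * (1 - norm b) / \<delta>\<^sup>2 + 104 * \<delta> \<le> \<epsilon> / B" by (simp add: field_simps)
      then have "B * (2 * (1 - norm b) / \<delta>\<^sup>2 + 104 * \<delta>) \<le> B * (\<epsilon> / B)"
        using B by (intro mult_left_mono) auto
      then show "B * (2 * (1 - norm b) / \<delta>\<^sup>2 + 104 * \<delta>) \<le> \<epsilon>" using B by simp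
    qed
    finally show "kernel_pairing a b \<le> \<epsilon>" using \<epsilon> by (simp add: ennreal_le_iff)
  qed
qed

subsection \<open>Holomorphic self-maps of the disc\<close>

lemma Schwarz_Pick_deriv:
  assumes holf: "f holomorphic_on \<D>" and im: "f ` \<D> \<subseteq> \<D>" and a: "a \<in> \<D>"
  shows "norm (deriv f a) * (1 - (norm a)\<^sup>2) \<le> 1 - (norm (f a))\<^sup>2"
proof -
  define w where "w = f a"
  let ?M = "Moebius_function 0"
  have w: "norm w < 1" using im a by (auto simp: w_def image_subset_iff)
  have a1: "norm a < 1" using a by simp
  define F where "F = ?M w \<circ> (f \<circ> ?M (- a))"
  have M0: "?M (- a) 0 = a" by (simp add: Moebius_function_of_zero)
  have Mim: "?M (- a) ` \<D> \<subseteq> \<D>" "?M w ` \<D> \<subseteq> \<D>"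
    using a1 w by (auto intro!: Moebius_function_norm_lt_1)
  have hol: "F holomorphic_on \<D>"
    unfolding F_def using Mim im a1 w
    by (intro holomorphic_on_compose_gen[of _ \<D> _ \<D>] Moebius_function_holomorphic holf)
      (auto simp: o_def image_subset_iff)
  have "norm (deriv F 0) \<le> 1"
  proof (rule Schwarz_Lemma(2)[OF hol])
    show "F 0 = 0" by (simp add: F_def M0 w_def Moebius_function_eq_zero)
    show "norm (F z) < 1" if "norm z < 1" for z
      using Mim im that by (auto simp: F_def image_subset_iff)
    show "norm (0::complex) < 1" by simp
  qed
  have dM1: "(?M (- a) has_field_derivative of_real (1 - (norm a)\<^sup>2)) (at 0)"
    unfolding Moebius_function_def
    by (rule derivative_eq_intros refl | simp)+
      (use complex_norm_square[of a] in \<open>simp add: power2_eq_square algebra_simps\<close>)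
  have ne: "1 - cnj w * w \<noteq> 0"
    using one_minus_cnj_mult_nonzero[of w w] w by simp
  have cw: "1 - cnj w * w = of_real (1 - (norm w)\<^sup>2)"
    using complex_norm_square[of w] by (simp add: mult.commute)
  have dM2: "(?M w has_field_derivative 1 / of_real (1 - (norm w)\<^sup>2)) (at w)"
    unfolding Moebius_function_simple[abs_def] cw[symmetric]
    by (rule derivative_eq_intros refl ne)+ (use ne in \<open>simp add: divide_simps\<close>)
  have df: "(f has_field_derivative deriv f a) (at a)"
    using holf a by (simp add: holomorphic_derivI)
  have "(F has_field_derivative (1 / of_real (1 - (norm w)\<^sup>2)) * (deriv f a * of_real (1 - (norm a)\<^sup>2))) (at 0)"
    unfolding F_def
    by (intro DERIV_chain) (use dM1 dM2 df in \<open>simp_all add: M0 w_def[symmetric]\<close>)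
  then have "deriv F 0 = (1 / of_real (1 - (norm w)\<^sup>2)) * (deriv f a * of_real (1 - (norm a)\<^sup>2))"
    by (rule DERIV_imp_deriv)
  then have "norm (deriv F 0) = norm (deriv f a) * (1 - (norm a)\<^sup>2) / (1 - (norm w)\<^sup>2)"
    using one_minus_norm_square_bounds(1)[OF w] one_minus_norm_square_bounds(1)[OF a1]
    by (simp add: norm_mult norm_divide del: of_real_diff)
  with \<open>norm (deriv F 0) \<le> 1\<close> show ?thesis
    using one_minus_norm_square_bounds(1)[OF w] by (simp add: w_def field_simps)
qed

lemma non_identity_self_map_moves_far:
  assumes holf: "f holomorphic_on \<D>" and im: "f ` \<D> \<subseteq> \<D>"
    and ne: "z0 \<in> \<D>" "f z0 \<noteq> z0" and r: "r < 1" and \<epsilon>: "0 < \<epsilon>"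
  obtains z where "r < norm z" "norm z < 1" "hyp_prox z (f z) < \<epsilon>"
proof (rule ccontr)
  assume "\<not> thesis"
  then have big: "\<epsilon> \<le> hyp_prox z (f z)" if "r < norm z" "norm z < 1" for z
    using that \<open>\<And>z. r < norm z \<Longrightarrow> norm z < 1 \<Longrightarrow> hyp_prox z (f z) < \<epsilon> \<Longrightarrow> thesis\<close> by force
  have near: "(norm (f z - z))\<^sup>2 \<le> (1 - (norm z)\<^sup>2) / \<epsilon>" if z: "r < norm z" "norm z < 1" for z
  proof -
    have w: "norm (f z) < 1" using im z by (auto simp: image_subset_iff)
    have "\<epsilon> * (norm (1 - cnj z * f z))\<^sup>2 \<le> (1 - (norm z)\<^sup>2) * (1 - (norm (f z))\<^sup>2)"
      using big[OF z] one_minus_cnj_mult_nonzero[of z "f z"] z w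
      by (simp add: hyp_prox_eq poisson_kernel_def field_simps)
    also have "\<dots> \<le> 1 - (norm z)\<^sup>2"
      using one_minus_norm_square_bounds[OF z(2)] one_minus_norm_square_bounds[OF w]
      by (intro mult_left_le) auto
    finally have far: "(norm (1 - cnj z * f z))\<^sup>2 \<le> (1 - (norm z)\<^sup>2) / \<epsilon>"
      using \<epsilon> by (simp add: field_simps)
    have "(norm (z - f z))\<^sup>2 \<le> (norm (1 - cnj z * f z))\<^sup>2"
      using norm_one_minus_cnj_mult_square[of z "f z"]
        one_minus_norm_square_bounds[OF z(2)] one_minus_norm_square_bounds[OF w] by simp
    from order_trans[OF this far] show ?thesis by (simp add: norm_minus_commute)
  qed
  have bound: "(norm (f z0 - z0))\<^sup>2 \<le> (1 - s\<^sup>2) / \<epsilon>" if s: "max r (norm z0) < s" "s < 1" for s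
  proof -
    have s0: "0 < s" using s norm_ge_zero[of z0] by linarith
    have sub: "cball 0 s \<subseteq> \<D>" using s by auto
    have hol: "(\<lambda>z. f z - z) holomorphic_on \<D>" by (intro holomorphic_intros holf)
    have "norm (f z0 - z0) \<le> sqrt ((1 - s\<^sup>2) / \<epsilon>)"
    proof (rule maximum_modulus_frontier[where f = "\<lambda>z. f z - z" and S = "cball 0 s"])
      show "(\<lambda>z. f z - z) holomorphic_on interior (cball 0 s)"
        using hol sub by (meson holomorphic_on_subset interior_subset subset_trans)
      show "continuous_on (closure (cball 0 s)) (\<lambda>z. f z - z)"
        using holomorphic_on_imp_continuous_on[OF hol] sub continuous_on_subset by (metis closed_cball closure_closed)
      fix z assume "z \<in> frontier (cball (0::complex) s)"
      then have "norm z = s" by (simp add: frontier_cball)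
      then show "norm (f z - z) \<le> sqrt ((1 - s\<^sup>2) / \<epsilon>)"
        using near[of z] s by (intro real_le_rsqrt) auto
    qed (use s in auto)
    then have "(norm (f z0 - z0))\<^sup>2 \<le> (sqrt ((1 - s\<^sup>2) / \<epsilon>))\<^sup>2"
      by (intro power_mono) auto
    also have "\<dots> = (1 - s\<^sup>2) / \<epsilon>"
      using s s0 \<epsilon> by (simp add: abs_square_le_1)
    finally show ?thesis .
  qed
  have "((\<lambda>s. (1 - s\<^sup>2) / \<epsilon>) \<longlongrightarrow> (1 - 1\<^sup>2) / \<epsilon>) (at_left (1::real))"
    by (intro tendsto_intros) (use \<epsilon> in auto)
  moreover have "eventually (\<lambda>s. (norm (f z0 - z0))\<^sup>2 \<le> (1 - s\<^sup>2) / \<epsilon>) (at_left 1)"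
    using eventually_at_left_real[of "max r (norm z0)" 1] r ne(1)
    by (auto elim!: eventually_mono intro!: bound)
  ultimately have "(norm (f z0 - z0))\<^sup>2 \<le> (1 - 1\<^sup>2) / \<epsilon>"
    by (rule tendsto_lowerbound) simp
  then show False using ne by simp
qed

lemma disc_semigroup_nontrivial_small_times:
  assumes sg: "disc_semigroup \<phi>" and nt: "\<not> trivial_semigroup \<phi>" and T: "0 < T"
  obtains t z where "0 < t" "t < T" "z \<in> \<D>" "\<phi> t z \<noteq> z"
proof -
  obtain t0 z0 where t0: "0 \<le> t0" "z0 \<in> \<D>" "\<phi> t0 z0 \<noteq> z0"
    using nt by (auto simp: trivial_semigroup_def)
  have id0: "\<phi> 0 z = z" if "z \<in> \<D>" for z using sg that by (simp add: disc_semigroup_def)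
  have t0pos: "0 < t0" using t0 id0 by (cases "t0 = 0") auto
  obtain n :: nat where n: "t0 / T < n" using reals_Archimedean2 by blast
  define t where "t = t0 / n"
  have npos: "0 < real n" using n t0pos T by (smt (verit) divide_pos_pos)
  have t: "0 < t" "t < T" using n npos t0pos T by (auto simp: t_def field_simps)
  have "\<exists>z\<in>\<D>. \<phi> t z \<noteq> z"
  proof (rule ccontr)
    assume "\<not> ?thesis"
    then have id: "\<phi> t z = z" if "z \<in> \<D>" for z using that by blast
    have "\<phi> (real k * t) z0 = z0" for k
    proof (induction k)
      case 0 then show ?case using id0 t0 by simp
    next
      case (Suc k)
      have "\<phi> t (\<phi> (real k * t) z0) = \<phi> (t + real k * t) z0"
        using sg t t0 by (auto simp: disc_semigroup_def)
      then show ?case using Suc id t0 by (simp add: algebra_simps)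
    qed
    from this[of n] show False using t0 npos by (simp add: t_def)
  qed
  then show ?thesis using that t by blast
qed

subsection \<open>The Bloch seminorm and the norm of \<open>BMOA\<^sub>p\<close>\<close>

lemma bmoa_integrand_eq:
  assumes "a \<in> \<D>" "z \<in> \<D>"
  shows "x * (1 - (norm z)\<^sup>2) powr (p - 2) * (1 - (norm (disc_aut a z))\<^sup>2) =
    x * (1 - (norm z)\<^sup>2) powr (p - 1) * poisson_kernel a z"
proof -
  have s: "0 < 1 - (norm z)\<^sup>2" using one_minus_norm_square_bounds(1)[of z] assms by simp
  have "(1 - (norm z)\<^sup>2) powr (p - 1) = (1 - (norm z)\<^sup>2) powr ((p - 2) + 1)" by simp
  also have "\<dots> = (1 - (norm z)\<^sup>2) powr (p - 2) * (1 - (norm z)\<^sup>2)"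
    unfolding powr_add using s by simp
  finally show ?thesis
    using hyp_prox_eq[of a z] assms by (simp add: hyp_prox_def)
qed

lemma ennreal_powr_lower:
  assumes "ennreal y \<le> x" "0 \<le> y" "0 \<le> r"
  shows "ennreal (y powr r) \<le> ennreal_powr x r"
proof (cases "x = \<infinity>")
  case False
  then obtain x' where x: "x = ennreal x'" "0 \<le> x'" by (cases x) auto
  then have "y \<le> x'" using assms by simp
  then show ?thesis using x False assms by (auto simp: ennreal_powr_def intro!: ennreal_leI powr_mono2)
qed (simp add: ennreal_powr_def)

lemma BMOA_I:
  assumes p: "1 \<le> p" and holf: "f holomorphic_on \<D>"
    and u: "u \<in> borel_measurable borel"
    and fu: "\<And>z. z \<in> \<D> \<Longrightarrow> norm (deriv f z) \<le> u z"
    and M: "\<And>z. z \<in> \<D> \<Longrightarrow> u z * (1 - (norm z)\<^sup>2) \<le> M"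
    and C: "\<And>a. a \<in> \<D> \<Longrightarrow> (\<integral>\<^sup>+z. ennreal (u z * poisson_kernel a z) \<partial>area_measure) \<le> ennreal C"
  shows "f \<in> BMOA p"
proof -
  have "(\<lambda>z. ennreal (u z * poisson_kernel a z)) \<in> borel_measurable borel" for a
    using u by measurable
  note meas = borel_measurable_area_measure[OF this]
  have "(\<integral>\<^sup>+ z. ennreal (norm (deriv f z) powr p * (1 - (norm z)\<^sup>2) powr (p - 2) *
            (1 - (norm (disc_aut a z))\<^sup>2)) \<partial>area_measure) \<le> ennreal (M powr (p - 1)) * ennreal C"
    if a: "a \<in> \<D>" for a
  proof -
    have "(\<integral>\<^sup>+ z. ennreal (norm (deriv f z) powr p * (1 - (norm z)\<^sup>2) powr (p - 2) *
            (1 - (norm (disc_aut a z))\<^sup>2)) \<partial>area_measure)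
      \<le> (\<integral>\<^sup>+ z. ennreal (M powr (p - 1)) * ennreal (u z * poisson_kernel a z) \<partial>area_measure)"
    proof (rule nn_integral_mono)
      fix z assume "z \<in> space area_measure"
      then have z: "z \<in> \<D>" by simp
      define x where "x = norm (deriv f z)"
      define s where "s = 1 - (norm z)\<^sup>2"
      have s: "0 < s" using z one_minus_norm_square_bounds(1)[of z] by (simp add: s_def)
      have x: "0 \<le> x" "x \<le> u z" using fu[OF z] by (auto simp: x_def)
      have K: "0 \<le> poisson_kernel a z" using a by (simp add: poisson_kernel_nonneg)
      have "x powr p * s powr (p - 1) \<le> M powr (p - 1) * u z"
      proof (cases "x = 0")
        case True
        then show ?thesis using x by simp
      next
        case False
        have "x powr p = x powr ((p - 1) + 1)" by simp
        also have "\<dots> = x powr (p - 1) * x" unfolding powr_add using False x by simp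
        finally have "x powr p * s powr (p - 1) = (x * s) powr (p - 1) * x"
          using x s by (simp add: powr_mult)
        also have "\<dots> \<le> M powr (p - 1) * u z"
        proof (intro mult_mono powr_mono2)
          have "x * s \<le> u z * s" using x s by (intro mult_right_mono) auto
          then show "x * s \<le> M" using M[OF z] by (simp add: s_def)
        qed (use x s p in auto)
        finally show ?thesis .
      qed
      then have "x powr p * s powr (p - 1) * poisson_kernel a z \<le> M powr (p - 1) * u z * poisson_kernel a z"
        using K by (rule mult_right_mono)
      then show "ennreal (norm (deriv f z) powr p * (1 - (norm z)\<^sup>2) powr (p - 2) *
            (1 - (norm (disc_aut a z))\<^sup>2)) \<le> ennreal (M powr (p - 1)) * ennreal (u z * poisson_kernel a z)"
        unfolding bmoa_integrand_eq[OF a z] unfolding x_def[symmetric] s_def[symmetric] using x K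
        by (subst ennreal_mult[symmetric]) (auto intro!: ennreal_leI simp: mult.assoc)
    qed
    also have "\<dots> = ennreal (M powr (p - 1)) * (\<integral>\<^sup>+ z. ennreal (u z * poisson_kernel a z) \<partial>area_measure)"
      by (rule nn_integral_cmult[OF meas])
    also have "\<dots> \<le> ennreal (M powr (p - 1)) * ennreal C" by (intro mult_left_mono C a) simp
    finally show ?thesis .
  qed
  then have "(SUP a\<in>\<D>. \<integral>\<^sup>+ z. ennreal (norm (deriv f z) powr p * (1 - (norm z)\<^sup>2) powr (p - 2) *
            (1 - (norm (disc_aut a z))\<^sup>2)) \<partial>area_measure) \<le> ennreal (M powr (p - 1)) * ennreal C"
    by (rule SUP_least)
  also have "\<dots> < \<infinity>" by (simp add: ennreal_mult_less_top)
  finally have "bmoa_norm p f < \<infinity>"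
    by (simp add: bmoa_norm_def ennreal_powr_def less_top[symmetric])
  with holf show ?thesis by (simp add: BMOA_def)
qed

text \<open>By Cauchy's estimate \<open>H''\<close> is of order \<open>(1 - |a|)\<^sup>-\<^sup>2\<close> near \<open>a\<close>, so \<open>H'\<close> is nearly constant on a small
  hyperbolic disc.\<close>

lemma Bloch_deriv_lower_bound_near:
  assumes holH: "H holomorphic_on \<D>" and a: "a \<in> \<D>" and \<delta>: "0 < \<delta>" and M: "0 < M"
    and Bloch: "\<And>z. z \<in> \<D> \<Longrightarrow> norm (deriv H z) * (1 - (norm z)\<^sup>2) \<le> M"
    and low: "\<delta> \<le> norm (deriv H a) * (1 - (norm a)\<^sup>2)"
    and z: "norm (z - a) < min (1/4) (\<delta> / (32 * M)) * (1 - norm a)"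
  shows "\<delta> / (4 * (1 - norm a)) \<le> norm (deriv H z)"
proof -
  define d where "d = 1 - norm a"
  have d: "0 < d" using a by (simp add: d_def)
  have z4: "norm (z - a) < d / 4"
    using z d unfolding d_def[symmetric] by (auto simp: min_mult_distrib_right)
  have zM: "norm (z - a) \<le> \<delta> * d / (32 * M)"
    using z d unfolding d_def[symmetric] by (auto simp: min_mult_distrib_right)
  have sub: "norm y \<le> 1 - d / 2" if "norm (y - a) \<le> d / 2" for y
    using that norm_triangle_sub[of y a] d_def by linarith
  have upper: "norm (deriv H y) \<le> 2 * M / d" if y: "norm (y - a) \<le> d / 2" for y
  proof -
    have y1: "norm y < 1" using sub[OF y] d by simp
    have "norm (deriv H y) * (d / 2) \<le> norm (deriv H y) * (1 - (norm y)\<^sup>2)"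
      using sub[OF y] one_minus_norm_square_bounds(4)[OF y1] by (intro mult_left_mono) auto
    also have "\<dots> \<le> M" using Bloch[of y] y1 by simp
    finally show ?thesis using d by (simp add: field_simps)
  qed
  have hol': "deriv H holomorphic_on \<D>" using holH by (simp add: holomorphic_deriv)
  have "norm (deriv (deriv H) y) \<le> 8 * M / d\<^sup>2" if y: "y \<in> ball a (d/4)" for y
  proof -
    have yd: "norm (y - a) < d / 4" using y by (simp add: dist_norm norm_minus_commute)
    have in2: "norm (w - a) \<le> d / 2" if "norm (y - w) \<le> d / 4" for w
      using yd that norm_triangle_ineq[of "w - y" "y - a"] by (simp add: norm_minus_commute)
    have cb: "cball y (d/4) \<subseteq> \<D>"
      using in2 sub d by (force simp: dist_norm)
    have "norm ((deriv ^^ 1) (deriv H) y) \<le> fact 1 * (2 * M / d) / (d/4) ^ 1"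
    proof (rule Cauchy_inequality)
      show "deriv H holomorphic_on ball y (d/4)"
        using hol' cb ball_subset_cball holomorphic_on_subset by (metis subset_trans)
      show "continuous_on (cball y (d/4)) (deriv H)"
        using hol' cb by (meson holomorphic_on_imp_continuous_on holomorphic_on_subset)
    qed (use d in2 upper in auto)
    then show ?thesis using d by (simp add: power2_eq_square)
  qed
  then have "norm (deriv H z - deriv H a) \<le> 8 * M / d\<^sup>2 * norm (z - a)"
  proof (intro field_differentiable_bound[of "ball a (d/4)" "deriv H" "deriv (deriv H)"])
    fix y assume y: "y \<in> ball a (d/4)"
    then have "norm (y - a) \<le> d/2" using d by (simp add: dist_norm norm_minus_commute)
    then have "y \<in> \<D>" using sub[of y] d by simp
    then show "(deriv H has_field_derivative deriv (deriv H) y) (at y within ball a (d/4))"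
      using hol' by (meson holomorphic_derivI open_ball)
  qed (use z4 d in \<open>auto simp: dist_norm norm_minus_commute\<close>)
  also have "\<dots> \<le> 8 * M / d\<^sup>2 * (\<delta> * d / (32 * M))"
    using zM M by (intro mult_left_mono) auto
  also have "\<dots> = \<delta> / (4 * d)" using M d by (simp add: field_simps power2_eq_square)
  finally have diff: "norm (deriv H z - deriv H a) \<le> \<delta> / (4 * d)" .
  have "norm (deriv H a) * (1 - (norm a)\<^sup>2) \<le> norm (deriv H a) * (2 * d)"
    using one_minus_norm_square_bounds(3)[of a] a by (intro mult_left_mono) (auto simp: d_def)
  then have "\<delta> / (2 * d) \<le> norm (deriv H a)" using low d by (simp add: field_simps)
  moreover have "\<delta> / (2 * d) = \<delta> / (4 * d) + \<delta> / (4 * d)" using d by (simp add: field_simps)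
  moreover have "norm (deriv H a) \<le> norm (deriv H z) + norm (deriv H z - deriv H a)"
    using norm_triangle_sub[of "deriv H a" "deriv H z"] by (simp add: norm_minus_commute)
  ultimately show ?thesis using diff unfolding d_def[symmetric] by linarith
qed

lemma bmoa_norm_lower_bound:
  assumes p: "1 \<le> p" and \<delta>: "0 < \<delta>" and M: "0 < M"
  obtains c where "0 < c"
    "\<And>H a. H holomorphic_on \<D> \<Longrightarrow> a \<in> \<D> \<Longrightarrow>
      (\<And>z. z \<in> \<D> \<Longrightarrow> norm (deriv H z) * (1 - (norm z)\<^sup>2) \<le> M) \<Longrightarrow>
      \<delta> \<le> norm (deriv H a) * (1 - (norm a)\<^sup>2) \<Longrightarrow> ennreal c \<le> bmoa_norm p H"
proof -
  define \<epsilon> where "\<epsilon> = min (1/4) (\<delta> / (32 * M))"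
  have \<epsilon>: "0 < \<epsilon>" "\<epsilon> \<le> 1/4" using \<delta> M by (auto simp: \<epsilon>_def)
  define c1 where "c1 = (\<delta>/4) powr p * (1/2) powr (p - 1) / 9"
  have c1: "0 < c1" using \<delta> by (simp add: c1_def)
  show ?thesis
  proof (rule that[of "(c1 * \<epsilon>\<^sup>2) powr (1/p)"])
    show "0 < (c1 * \<epsilon>\<^sup>2) powr (1/p)" using c1 \<epsilon> by simp
    fix H a
    assume holH: "H holomorphic_on \<D>" and a: "a \<in> \<D>"
      and Bloch: "\<And>z. z \<in> \<D> \<Longrightarrow> norm (deriv H z) * (1 - (norm z)\<^sup>2) \<le> M"
      and low: "\<delta> \<le> norm (deriv H a) * (1 - (norm a)\<^sup>2)"
    define d where "d = 1 - norm a"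
    have d: "0 < d" using a by (simp add: d_def)
    let ?I = "\<lambda>z. norm (deriv H z) powr p * (1 - (norm z)\<^sup>2) powr (p - 2) * (1 - (norm (disc_aut a z))\<^sup>2)"
    have zd: "norm z \<le> 1 - d/2" if "z \<in> ball a (\<epsilon> * d)" for z
    proof -
      have "\<epsilon> * d \<le> 1/4 * d" using \<epsilon> d by (intro mult_right_mono) auto
      moreover have "norm (z - a) < \<epsilon> * d" using that by (simp add: dist_norm norm_minus_commute)
      ultimately show ?thesis
        using norm_triangle_sub[of z a] d d_def by linarith
    qed
    have sub: "ball a (\<epsilon> * d) \<subseteq> \<D>" using zd d by fastforce
    have pw: "c1 / d\<^sup>2 \<le> ?I z" if z: "z \<in> ball a (\<epsilon> * d)" for z
    proof -
      have zD: "z \<in> \<D>" using z sub by blast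
      have nz: "norm (z - a) < \<epsilon> * d" using z by (simp add: dist_norm norm_minus_commute)
      have "\<delta> / (4 * d) \<le> norm (deriv H z)"
        unfolding d_def
        using nz by (intro Bloch_deriv_lower_bound_near[OF holH a \<delta> M Bloch low]) (auto simp: \<epsilon>_def d_def)
      then have 1: "(\<delta>/4) powr p / d powr p \<le> norm (deriv H z) powr p"
        using powr_mono2[of p "\<delta> / (4 * d)" "norm (deriv H z)"] \<delta> d p by (simp add: powr_divide powr_mult)
      have "d / 2 \<le> 1 - (norm z)\<^sup>2"
        using zd[OF z] one_minus_norm_square_bounds(4)[of z] zD by simp
      then have 2: "(1/2) powr (p - 1) * (d powr p / d) \<le> (1 - (norm z)\<^sup>2) powr (p - 1)"
        using powr_mono2[of "p - 1" "d / 2" "1 - (norm z)\<^sup>2"] d p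
        by (simp add: powr_divide powr_diff mult.commute)
      have "norm (1 - cnj a * z) \<le> 3 * d"
      proof -
        have "1 - cnj a * z = of_real (1 - (norm a)\<^sup>2) - cnj a * (z - a)"
          using complex_norm_square[of a] by (simp add: algebra_simps)
        then have "norm (1 - cnj a * z) \<le> \<bar>1 - (norm a)\<^sup>2\<bar> + norm a * norm (z - a)"
          by (metis norm_triangle_ineq4 norm_of_real norm_mult complex_mod_cnj)
        also have "\<dots> \<le> 2 * d + 1 * d"
        proof (intro add_mono mult_mono)
          show "\<bar>1 - (norm a)\<^sup>2\<bar> \<le> 2 * d"
            using one_minus_norm_square_bounds[of a] a by (simp add: d_def)
          have "\<epsilon> * d \<le> 1 * d" using \<epsilon> d by (intro mult_right_mono) auto
          then show "norm (z - a) \<le> d" using nz by simp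
        qed (use a in auto)
        finally show ?thesis by simp
      qed
      then have "d / (3 * d)\<^sup>2 \<le> poisson_kernel a z"
        unfolding poisson_kernel_def
        using one_minus_cnj_mult_nonzero[of a z] one_minus_norm_square_bounds[of a] a zD d
        by (intro frac_le power_mono) (auto simp: d_def)
      then have 3: "1 / (9 * d) \<le> poisson_kernel a z"
        using d by (simp add: power2_eq_square)
      have "c1 / d\<^sup>2 = ((\<delta>/4) powr p / d powr p) * ((1/2) powr (p - 1) * (d powr p / d)) * (1 / (9 * d))"
        using d by (simp add: c1_def power2_eq_square)
      also have "\<dots> \<le> norm (deriv H z) powr p * (1 - (norm z)\<^sup>2) powr (p - 1) * poisson_kernel a z"
        using d by (intro mult_mono 1 2 3) auto
      finally show ?thesis unfolding bmoa_integrand_eq[OF a zD] .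
    qed
    have "ennreal (c1 * \<epsilon>\<^sup>2) = ennreal (c1 / d\<^sup>2) * ennreal ((\<epsilon> * d)\<^sup>2)"
      using d c1 by (simp add: power_mult_distrib flip: ennreal_mult)
    also have "\<dots> = ennreal (c1 / d\<^sup>2) * emeasure area_measure (ball a (\<epsilon> * d))"
      using emeasure_area_measure_ball[OF _ sub] \<epsilon> d by simp
    also have "\<dots> = (\<integral>\<^sup>+z. ennreal (c1 / d\<^sup>2) * indicator (ball a (\<epsilon> * d)) z \<partial>area_measure)"
      using sub by (intro nn_integral_cmult_indicator[symmetric] sets_area_measureI) auto
    also have "\<dots> \<le> (\<integral>\<^sup>+z. ennreal (?I z) \<partial>area_measure)"
      using pw by (intro nn_integral_mono) (auto simp: indicator_def intro!: ennreal_leI)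
    also have "\<dots> \<le> (SUP a\<in>\<D>. \<integral>\<^sup>+ z. ennreal (norm (deriv H z) powr p * (1 - (norm z)\<^sup>2) powr (p - 2) *
                                  (1 - (norm (disc_aut a z))\<^sup>2)) \<partial>area_measure)"
      by (rule SUP_upper[OF a])
    finally have "ennreal (c1 * \<epsilon>\<^sup>2) \<le> ennreal (norm (H 0) powr p) +
      (SUP a\<in>\<D>. \<integral>\<^sup>+ z. ennreal (norm (deriv H z) powr p * (1 - (norm z)\<^sup>2) powr (p - 2) *
                                  (1 - (norm (disc_aut a z))\<^sup>2)) \<partial>area_measure)"
      by (rule order_trans) simp
    then show "ennreal ((c1 * \<epsilon>\<^sup>2) powr (1/p)) \<le> bmoa_norm p H"
      unfolding bmoa_norm_def using c1 p by (intro ennreal_powr_lower) auto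
  qed
qed

lemma strong_cont_space_Bloch_small:
  assumes p: "1 \<le> p" and sg: "disc_semigroup \<phi>"
    and f: "f \<in> strong_cont_space \<phi> (BMOA p) (bmoa_norm p)"
    and Bloch: "\<And>z. z \<in> \<D> \<Longrightarrow> norm (deriv f z) * (1 - (norm z)\<^sup>2) \<le> M"
    and \<delta>: "0 < \<delta>"
  obtains T where "0 < T"
    "\<And>t a. 0 < t \<Longrightarrow> t < T \<Longrightarrow> a \<in> \<D> \<Longrightarrow>
      norm (deriv f (\<phi> t a) * deriv (\<phi> t) a - deriv f a) * (1 - (norm a)\<^sup>2) < \<delta>"
proof -
  have holf: "f holomorphic_on \<D>" using f by (simp add: strong_cont_space_def BMOA_def)
  have M0: "0 \<le> M" using Bloch[of 0] order_trans[OF norm_ge_zero] by simp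
  obtain c where c: "0 < c" and lower:
    "\<And>H a. H holomorphic_on \<D> \<Longrightarrow> a \<in> \<D> \<Longrightarrow>
      (\<And>z. z \<in> \<D> \<Longrightarrow> norm (deriv H z) * (1 - (norm z)\<^sup>2) \<le> 2 * M + 1) \<Longrightarrow>
      \<delta> \<le> norm (deriv H a) * (1 - (norm a)\<^sup>2) \<Longrightarrow> ennreal c \<le> bmoa_norm p H"
    using bmoa_norm_lower_bound[OF p \<delta>, of "2 * M + 1"] M0 by auto
  have "((\<lambda>t. bmoa_norm p (\<lambda>z. (f \<circ> \<phi> t) z - f z)) \<longlongrightarrow> 0) (at_right 0)"
    using f by (simp add: strong_cont_space_def)
  then have "eventually (\<lambda>t. bmoa_norm p (\<lambda>z. (f \<circ> \<phi> t) z - f z) < ennreal c) (at_right 0)"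
    using c by (intro order_tendstoD(2)) auto
  then obtain T where T: "0 < T"
    "\<And>t. 0 < t \<Longrightarrow> t < T \<Longrightarrow> bmoa_norm p (\<lambda>z. (f \<circ> \<phi> t) z - f z) < ennreal c"
    by (auto simp: eventually_at_right_field)
  show ?thesis
  proof (rule that[OF T(1)], rule ccontr)
    fix t a assume t: "0 < t" "t < T" and a: "a \<in> \<D>"
      and "\<not> norm (deriv f (\<phi> t a) * deriv (\<phi> t) a - deriv f a) * (1 - (norm a)\<^sup>2) < \<delta>"
    then have ge: "\<delta> \<le> norm (deriv f (\<phi> t a) * deriv (\<phi> t) a - deriv f a) * (1 - (norm a)\<^sup>2)" by simp
    let ?H = "\<lambda>z. (f \<circ> \<phi> t) z - f z"
    have hol: "\<phi> t holomorphic_on \<D>" and im: "\<phi> t ` \<D> \<subseteq> \<D>"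
      using sg t by (auto simp: disc_semigroup_def)
    have dH: "(?H has_field_derivative deriv f (\<phi> t z) * deriv (\<phi> t) z - deriv f z) (at z)"
      if z: "z \<in> \<D>" for z
    proof (intro DERIV_diff DERIV_chain)
      show "(f has_field_derivative deriv f (\<phi> t z)) (at (\<phi> t z))"
        using holf im z by (meson holomorphic_derivI image_subset_iff open_ball)
    qed (use holf hol z in \<open>auto intro: holomorphic_derivI[OF _ open_ball]\<close>)
    note derivH = DERIV_imp_deriv[OF dH]
    have holH: "?H holomorphic_on \<D>"
      unfolding holomorphic_on_open[OF open_ball] using dH by blast
    have "norm (deriv ?H z) * (1 - (norm z)\<^sup>2) \<le> 2 * M + 1" if z: "z \<in> \<D>" for z
    proof -
      define s where "s = 1 - (norm z)\<^sup>2"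
      have s: "0 < s" using z one_minus_norm_square_bounds(1)[of z] by (simp add: s_def)
      have wz: "\<phi> t z \<in> \<D>" using im z by blast
      have "norm (deriv ?H z) * s \<le> (norm (deriv f (\<phi> t z)) * norm (deriv (\<phi> t) z) + norm (deriv f z)) * s"
        unfolding derivH[OF z] norm_mult[symmetric] using s by (intro mult_right_mono norm_triangle_ineq4) auto
      also have "\<dots> = norm (deriv f (\<phi> t z)) * (norm (deriv (\<phi> t) z) * s) + norm (deriv f z) * s"
        by (simp add: algebra_simps)
      also have "\<dots> \<le> norm (deriv f (\<phi> t z)) * (1 - (norm (\<phi> t z))\<^sup>2) + norm (deriv f z) * s"
        using Schwarz_Pick_deriv[OF hol im z] by (intro add_right_mono mult_left_mono) (auto simp: s_def)
      also have "\<dots> \<le> M + M" using Bloch[OF wz] Bloch[OF z] by (simp add: s_def)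
      finally show ?thesis by (simp add: s_def)
    qed
    from lower[OF holH a this] ge T(2)[OF t] show False
      unfolding derivH[OF a] by (meson leD)
  qed
qed

subsection \<open>Superpositions of disc automorphisms\<close>

text \<open>On the disc \<open>bump b = b - disc_aut b\<close>.\<close>

definition bump :: "complex \<Rightarrow> complex \<Rightarrow> complex" where
  "bump b z = of_real (1 - (norm b)\<^sup>2) * z / (1 - cnj b * z)"

definition bump_deriv :: "complex \<Rightarrow> complex \<Rightarrow> complex" where
  "bump_deriv b z = of_real (1 - (norm b)\<^sup>2) / (1 - cnj b * z)\<^sup>2"

lemma has_field_derivative_bump:
  assumes "norm b < 1" "z \<in> \<D>"
  shows "(bump b has_field_derivative bump_deriv b z) (at z)"
proof -
  have ne: "1 - cnj b * z \<noteq> 0" using one_minus_cnj_mult_nonzero[of b z] assms by simp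
  define c where "c = complex_of_real (1 - (norm b)\<^sup>2)"
  have "((\<lambda>z. c * z / (1 - cnj b * z)) has_field_derivative c / (1 - cnj b * z)\<^sup>2) (at z)"
    using ne by (auto intro!: derivative_eq_intros simp: divide_simps power2_eq_square) (simp add: algebra_simps)
  then show ?thesis unfolding bump_def[abs_def] bump_deriv_def c_def .
qed

lemma norm_bump_deriv:
  assumes "norm b < 1"
  shows "norm (bump_deriv b z) = poisson_kernel b z"
  using one_minus_norm_square_bounds(1)[OF assms]
  by (simp add: bump_deriv_def poisson_kernel_def norm_divide norm_power del: of_real_diff)

lemma norm_bump_deriv_mult:
  assumes "norm b < 1" "norm z < 1"
  shows "norm (bump_deriv b z) * (1 - (norm z)\<^sup>2) = hyp_prox b z"
  using assms by (simp add: norm_bump_deriv hyp_prox_eq)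

lemma norm_bump_le:
  assumes b: "norm b < 1" and z: "norm z \<le> r" "r < 1"
  shows "norm (bump b z) \<le> hyp_prox 0 b / (1 - r)"
proof -
  have "norm (cnj b * z) \<le> r"
    using assms by (simp add: norm_mult) (meson less_imp_le mult_left_le_one_le norm_ge_zero order_trans)
  then have "1 - r \<le> norm (1 - cnj b * z)"
    using norm_triangle_ineq2[of 1 "cnj b * z"] by simp
  moreover have "norm (bump b z) = (1 - (norm b)\<^sup>2) * norm z / norm (1 - cnj b * z)"
    using one_minus_norm_square_bounds(1)[OF b] by (simp add: bump_def norm_mult norm_divide del: of_real_diff)
  moreover have "(1 - (norm b)\<^sup>2) * norm z \<le> 1 - (norm b)\<^sup>2"
    using one_minus_norm_square_bounds(1)[OF b] z by (intro mult_left_le) auto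
  ultimately have "norm (bump b z) \<le> (1 - (norm b)\<^sup>2) / (1 - r)"
    using z one_minus_norm_square_bounds(1)[OF b] by (auto intro!: frac_le)
  then show ?thesis by (simp add: hyp_prox_def disc_aut_def)
qed

definition interaction :: "complex \<Rightarrow> complex \<Rightarrow> real" where
  "interaction a b = hyp_prox a b + kernel_pairing a b"

lemma interaction_commute: "interaction a b = interaction b a"
  by (simp add: interaction_def hyp_prox_commute[of a] kernel_pairing_commute[of a])

lemma interaction_bounds:
  assumes "norm a < 1" "norm b < 1"
  shows "0 \<le> interaction a b" "interaction a b \<le> 201" "hyp_prox a b \<le> interaction a b"
    "kernel_pairing a b \<le> interaction a b"
  using hyp_prox_nonneg[OF assms] hyp_prox_le_1[of a b] kernel_pairing_nonneg[of a b] kernel_pairing_le[OF assms]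
  by (auto simp: interaction_def)

lemma interaction_decay:
  assumes r: "r < 1" and \<epsilon>: "0 < \<epsilon>"
  obtains s where "s < 1" "\<And>a b. norm a \<le> r \<Longrightarrow> s \<le> norm b \<Longrightarrow> norm b < 1 \<Longrightarrow> interaction a b \<le> \<epsilon>"
proof -
  obtain s where s: "s < 1"
    "\<And>a b. norm a \<le> r \<Longrightarrow> s \<le> norm b \<Longrightarrow> norm b < 1 \<Longrightarrow> kernel_pairing a b \<le> \<epsilon> / 2"
    using kernel_pairing_decay[OF r, of "\<epsilon> / 2"] \<epsilon> by auto
  define s' where "s' = max s (1 - \<epsilon> * (1 - r) / 8)"
  show ?thesis
  proof (rule that)
    show "s' < 1" using s r \<epsilon> by (simp add: s'_def)
    fix a b :: complex assume a: "norm a \<le> r" and b: "s' \<le> norm b" "norm b < 1"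
    have "hyp_prox a b \<le> 4 * (1 - norm b) / (1 - r)" using hyp_prox_le[OF a r b(2)] .
    also have "\<dots> \<le> \<epsilon> / 2" using b r by (simp add: s'_def field_simps)
    finally show "interaction a b \<le> \<epsilon>" using s(2)[of a b] a b by (simp add: interaction_def s'_def)
  qed
qed

lemma has_field_derivative_sum_bump:
  assumes "\<And>j. j < n \<Longrightarrow> norm (b j) < 1" "z \<in> \<D>"
  shows "((\<lambda>z. \<Sum>j<n. bump (b j) z) has_field_derivative (\<Sum>j<n. bump_deriv (b j) z)) (at z)"
  using assms by (intro DERIV_sum has_field_derivative_bump) auto

lemma sum_bump_BMOA:
  fixes n :: nat
  assumes p: "1 \<le> p" and b: "\<And>j. j < n \<Longrightarrow> norm (b j) < 1"
  shows "(\<lambda>z. \<Sum>j<n. bump (b j) z) \<in> BMOA p"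
    and "z \<in> \<D> \<Longrightarrow> norm (\<Sum>j<n. bump_deriv (b j) z) * (1 - (norm z)\<^sup>2) \<le> n"
proof -
  note der = has_field_derivative_sum_bump[of n b, OF b]
  have le: "norm (\<Sum>j<n. bump_deriv (b j) z) \<le> (\<Sum>j<n. poisson_kernel (b j) z)" for z
    using b by (intro sum_norm_le) (simp add: norm_bump_deriv)
  have n: "(\<Sum>j<n. poisson_kernel (b j) z) * (1 - (norm z)\<^sup>2) \<le> n" if z: "z \<in> \<D>" for z
  proof -
    have "(\<Sum>j<n. poisson_kernel (b j) z) * (1 - (norm z)\<^sup>2) = (\<Sum>j<n. hyp_prox (b j) z)"
      using z b by (simp add: sum_distrib_right hyp_prox_eq)
    also have "\<dots> \<le> (\<Sum>j<n. 1)" by (intro sum_mono hyp_prox_le_1)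
    finally show ?thesis by simp
  qed
  show "norm (\<Sum>j<n. bump_deriv (b j) z) * (1 - (norm z)\<^sup>2) \<le> n" if z: "z \<in> \<D>" for z
    using order_trans[OF mult_right_mono[OF le[of z], of "1 - (norm z)\<^sup>2"] n[OF z]]
      one_minus_norm_square_bounds(1)[of z] z by simp
  show "(\<lambda>z. \<Sum>j<n. bump (b j) z) \<in> BMOA p"
  proof (rule BMOA_I[OF p, where u = "\<lambda>z. \<Sum>j<n. poisson_kernel (b j) z" and M = n and C = "200 * n"])
    show "(\<lambda>z. \<Sum>j<n. bump (b j) z) holomorphic_on \<D>"
      unfolding holomorphic_on_open[OF open_ball] using der by blast
    show "norm (deriv (\<lambda>z. \<Sum>j<n. bump (b j) z) z) \<le> (\<Sum>j<n. poisson_kernel (b j) z)" if "z \<in> \<D>" for z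
      using DERIV_imp_deriv[OF der[OF _ that]] le[of z] by simp
    show "(\<integral>\<^sup>+z. ennreal ((\<Sum>j<n. poisson_kernel (b j) z) * poisson_kernel a z) \<partial>area_measure) \<le> ennreal (200 * n)"
      if a: "a \<in> \<D>" for a
    proof -
      note [measurable] = borel_measurable_area_measure[OF borel_measurable_poisson_kernel]
      have "(\<integral>\<^sup>+z. ennreal ((\<Sum>j<n. poisson_kernel (b j) z) * poisson_kernel a z) \<partial>area_measure)
        = (\<integral>\<^sup>+z. (\<Sum>j<n. ennreal (poisson_kernel (b j) z * poisson_kernel a z)) \<partial>area_measure)"
        using a b by (intro nn_integral_cong, subst sum_ennreal) (auto simp: sum_distrib_right poisson_kernel_nonneg)
      also have "\<dots> = (\<Sum>j<n. \<integral>\<^sup>+z. ennreal (poisson_kernel (b j) z * poisson_kernel a z) \<partial>area_measure)"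
        by (rule nn_integral_sum) measurable
      also have "\<dots> \<le> (\<Sum>j<n. 200)"
        using a b by (intro sum_mono nn_integral_kernel_product_le) auto
      also have "\<dots> = ennreal (200 * n)"
        by (simp add: ennreal_mult ennreal_of_nat_eq_real_of_nat mult.commute)
      finally show ?thesis .
    qed
  qed (use n in auto)
qed

lemma suminf_bump_BMOA:
  assumes p: "1 \<le> p" and b: "\<And>j. norm (b j) < 1"
    and summ: "\<And>a. a \<in> \<D> \<Longrightarrow> summable (\<lambda>j. interaction a (b j))"
    and M: "\<And>a. a \<in> \<D> \<Longrightarrow> (\<Sum>j. interaction a (b j)) \<le> M"
  obtains f where "f \<in> BMOA p" "\<And>z. z \<in> \<D> \<Longrightarrow> (\<lambda>j. bump_deriv (b j) z) sums deriv f z"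
    "\<And>z. z \<in> \<D> \<Longrightarrow> norm (deriv f z) * (1 - (norm z)\<^sup>2) \<le> M"
proof -
  have hp: "summable (\<lambda>j. hyp_prox a (b j))" "(\<Sum>j. hyp_prox a (b j)) \<le> M" if a: "a \<in> \<D>" for a
  proof -
    show s: "summable (\<lambda>j. hyp_prox a (b j))"
      using interaction_bounds[of a] hyp_prox_nonneg[of a] a b
      by (intro summable_comparison_test'[OF summ[OF a], of 0]) auto
    show "(\<Sum>j. hyp_prox a (b j)) \<le> M"
      using suminf_le[OF _ s summ[OF a]] M[OF a] interaction_bounds(3)[of a] a b by force
  qed
  have kp: "summable (\<lambda>j. kernel_pairing a (b j))" "(\<Sum>j. kernel_pairing a (b j)) \<le> M" if a: "a \<in> \<D>" for a
  proof -
    show s: "summable (\<lambda>j. kernel_pairing a (b j))"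
      using interaction_bounds[of a] kernel_pairing_nonneg[of a] a b
      by (intro summable_comparison_test'[OF summ[OF a], of 0]) auto
    show "(\<Sum>j. kernel_pairing a (b j)) \<le> M"
      using suminf_le[OF _ s summ[OF a]] M[OF a] interaction_bounds(4)[of a] a b by force
  qed
  have "\<exists>g g'. \<forall>x\<in>\<D>. ((\<lambda>n. bump (b n) x) sums g x) \<and> ((\<lambda>n. bump_deriv (b n) x) sums g' x) \<and>
     (g has_field_derivative g' x) (at x)"
  proof (rule series_and_derivative_comparison_local)
    fix x :: complex assume x: "x \<in> \<D>"
    define d where "d = (1 - norm x) / 2"
    have d: "0 < d" using x by (simp add: d_def)
    have "norm (bump (b n) y) \<le> hyp_prox 0 (b n) / d" if "y \<in> ball x d" for n y
    proof -
      have "norm y \<le> 1 - d"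
        using that norm_triangle_sub[of y x] by (simp add: dist_norm norm_minus_commute d_def field_simps)
      from norm_bump_le[OF b this] d show ?thesis by simp
    qed
    moreover have "summable (\<lambda>n. hyp_prox 0 (b n) / d)"
      using hp(1)[of 0] by (intro summable_divide) simp
    ultimately show "\<exists>d h. 0 < d \<and> summable h \<and> (\<forall>\<^sub>F n in sequentially. \<forall>y\<in>ball x d \<inter> \<D>. norm (bump (b n) y) \<le> h n)"
      using d by (intro exI[of _ d] exI[of _ "\<lambda>n. hyp_prox 0 (b n) / d"]) auto
  qed (use b has_field_derivative_bump in auto)
  then obtain f f' where f: "\<And>x. x \<in> \<D> \<Longrightarrow> (\<lambda>n. bump_deriv (b n) x) sums f' x"
     "\<And>x. x \<in> \<D> \<Longrightarrow> (f has_field_derivative f' x) (at x)" by metis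
  have derf: "deriv f z = f' z" if "z \<in> \<D>" for z using f(2)[OF that] by (rule DERIV_imp_deriv)
  have sums: "(\<lambda>j. bump_deriv (b j) z) sums deriv f z" if "z \<in> \<D>" for z
    using f(1)[OF that] derf[OF that] by simp
  define u where "u z = (\<Sum>j. poisson_kernel (b j) z)" for z
  have su: "summable (\<lambda>j. poisson_kernel (b j) z)" and us: "u z * (1 - (norm z)\<^sup>2) \<le> M"
    and fu: "norm (deriv f z) \<le> u z" if z: "z \<in> \<D>" for z
  proof -
    have s: "0 < 1 - (norm z)\<^sup>2" using z one_minus_norm_square_bounds(1)[of z] by simp
    have eq: "poisson_kernel (b j) z * (1 - (norm z)\<^sup>2) = hyp_prox z (b j)" for j
      using hyp_prox_eq[of "b j" z] hyp_prox_commute[of z "b j"] b z by simp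
    then have "poisson_kernel (b j) z = hyp_prox z (b j) / (1 - (norm z)\<^sup>2)" for j
      using s by (simp add: field_simps)
    then show su: "summable (\<lambda>j. poisson_kernel (b j) z)"
      using hp(1)[OF z] by (simp add: summable_divide)
    show "u z * (1 - (norm z)\<^sup>2) \<le> M"
      unfolding u_def suminf_mult2[OF su] using hp(2)[OF z] by (simp add: eq)
    have "norm (\<Sum>j. bump_deriv (b j) z) \<le> (\<Sum>j. norm (bump_deriv (b j) z))"
      by (rule summable_norm) (simp add: norm_bump_deriv[OF b] su)
    then show "norm (deriv f z) \<le> u z"
      using sums_unique[OF sums[OF z]] by (simp add: u_def norm_bump_deriv[OF b])
  qed
  have "f \<in> BMOA p"
  proof (rule BMOA_I[OF p _ _ fu us])
    show "f holomorphic_on \<D>" unfolding holomorphic_on_open[OF open_ball] using f(2) by blast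
    show "u \<in> borel_measurable borel" unfolding u_def by measurable
    fix a :: complex assume a: "a \<in> \<D>"
    note [measurable] = borel_measurable_area_measure[OF borel_measurable_poisson_kernel]
    have "(\<integral>\<^sup>+z. ennreal (u z * poisson_kernel a z) \<partial>area_measure) =
      (\<integral>\<^sup>+z. (\<Sum>j. ennreal (poisson_kernel a z * poisson_kernel (b j) z)) \<partial>area_measure)"
    proof (rule nn_integral_cong)
      fix z assume "z \<in> space area_measure"
      then have z: "z \<in> \<D>" by simp
      have "u z * poisson_kernel a z = (\<Sum>j. poisson_kernel a z * poisson_kernel (b j) z)"
        unfolding u_def suminf_mult[OF su[OF z]] by simp
      then show "ennreal (u z * poisson_kernel a z) = (\<Sum>j. ennreal (poisson_kernel a z * poisson_kernel (b j) z))"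
        using a b summable_mult[OF su[OF z]] by (simp add: suminf_ennreal2 poisson_kernel_nonneg)
    qed
    also have "\<dots> = (\<Sum>j. \<integral>\<^sup>+z. ennreal (poisson_kernel a z * poisson_kernel (b j) z) \<partial>area_measure)"
      by (rule nn_integral_suminf) measurable
    also have "\<dots> = (\<Sum>j. ennreal (kernel_pairing a (b j)))"
      using a b by (simp add: ennreal_kernel_pairing)
    also have "\<dots> = ennreal (\<Sum>j. kernel_pairing a (b j))"
      using kp(1)[OF a] by (intro suminf_ennreal2) (auto simp: kernel_pairing_nonneg)
    also have "\<dots> \<le> ennreal M" using kp(2)[OF a] by (rule ennreal_leI)
    finally show "(\<integral>\<^sup>+z. ennreal (u z * poisson_kernel a z) \<partial>area_measure) \<le> ennreal M" .
  qed
  moreover have "norm (deriv f z) * (1 - (norm z)\<^sup>2) \<le> M" if z: "z \<in> \<D>" for z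
    using order_trans[OF mult_right_mono[OF fu[OF z], of "1 - (norm z)\<^sup>2"] us[OF z]]
      one_minus_norm_square_bounds(1)[of z] z by simp
  ultimately show ?thesis using that sums by blast
qed

text \<open>For each \<open>a\<close> at most one term escapes the geometric bounds: the first \<open>n\<close> with \<open>|a| < r n\<close>.\<close>

lemma gliding_interaction_sum:
  fixes b :: "nat \<Rightarrow> complex" and r :: "nat \<Rightarrow> real"
  assumes b: "\<And>n. norm (b n) < 1"
    and before: "\<And>j n a. j < n \<Longrightarrow> norm a \<le> r j \<Longrightarrow> interaction a (b n) \<le> (1/2) ^ n / 8"
    and beyond: "\<And>n a. r n \<le> norm a \<Longrightarrow> norm a < 1 \<Longrightarrow> interaction a (b n) \<le> (1/2) ^ n / 8"
    and a: "a \<in> \<D>"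
  shows "summable (\<lambda>n. interaction a (b n))" "(\<Sum>n. interaction a (b n)) \<le> 202"
proof -
  have a1: "norm a < 1" using a by simp
  have "\<exists>m. \<forall>n. n \<noteq> m \<longrightarrow> interaction a (b n) \<le> (1/2) ^ n / 8"
  proof (cases "\<exists>n. norm a < r n")
    case True
    define m where "m = (LEAST n. norm a < r n)"
    have "norm a < r m" unfolding m_def using True by (rule LeastI_ex)
    moreover have "r n \<le> norm a" if "n < m" for n
      using not_less_Least[of n "\<lambda>n. norm a < r n"] that by (simp add: m_def)
    ultimately show ?thesis
      using before[of m _ a] beyond[of _ a] a1 by (metis less_imp_le linorder_neqE_nat)
  next
    case False
    then show ?thesis using beyond[of _ a] a1 by (metis not_less)
  qed
  then obtain m where m: "\<And>n. n \<noteq> m \<Longrightarrow> interaction a (b n) \<le> (1/2) ^ n / 8" by blast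
  let ?h = "\<lambda>n. (1/2) ^ n / 8 + (if n = m then 201 else 0 :: real)"
  have le: "interaction a (b n) \<le> ?h n" for n
    using m[of n] interaction_bounds(2)[OF a1 b, of n] by (cases "n = m") (auto intro: add_increasing)
  have "(\<lambda>n. (1/2::real) ^ n / 8) sums (2 / 8)"
    using sums_divide[OF geometric_sums[of "1/2::real"], of 8] by simp
  moreover have "(\<lambda>n. if n = m then 201 else 0 :: real) sums 201"
    using sums_single[of m "\<lambda>_. 201::real"] by simp
  ultimately have h: "?h sums (2 / 8 + 201)" by (rule sums_add)
  show s: "summable (\<lambda>n. interaction a (b n))"
    using le interaction_bounds(1)[OF a1 b]
    by (intro summable_comparison_test'[OF sums_summable[OF h], of 0]) auto
  have "(\<Sum>n. interaction a (b n)) \<le> (\<Sum>n. ?h n)"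
    by (rule suminf_le[OF le s sums_summable[OF h]])
  also have "\<dots> = 2 / 8 + 201" using sums_unique[OF h] by simp
  finally show "(\<Sum>n. interaction a (b n)) \<le> 202" by simp
qed

subsection \<open>The gliding hump\<close>

lemma gliding_tail_le:
  fixes n :: nat
  assumes b: "\<And>n. norm (b n) < 1" and z: "z \<in> \<D>"
    and summ: "summable (\<lambda>j. bump_deriv (b j) z)"
    and small: "\<And>j. n < j \<Longrightarrow> interaction z (b j) \<le> (1/2) ^ j / 8"
  shows "norm ((\<Sum>j. bump_deriv (b j) z) - (\<Sum>j<Suc n. bump_deriv (b j) z)) * (1 - (norm z)\<^sup>2) \<le> 1/8"
proof -
  define s where "s = 1 - (norm z)\<^sup>2"
  have s: "0 < s" using z one_minus_norm_square_bounds(1)[of z] by (simp add: s_def)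
  let ?k = "\<lambda>j. bump_deriv (b (j + Suc n)) z"
  have le: "norm (?k j) \<le> (1/2) ^ j / 16 / s" for j
  proof -
    have "norm (?k j) * s = hyp_prox z (b (j + Suc n))"
      using norm_bump_deriv_mult[OF b, of z] z hyp_prox_commute by (simp add: s_def)
    also have "\<dots> \<le> interaction z (b (j + Suc n))" using z b by (intro interaction_bounds) auto
    also have "\<dots> \<le> (1/2) ^ (j + Suc n) / 8" by (rule small) simp
    also have "\<dots> \<le> (1/2) ^ Suc j / 8" by (intro divide_right_mono power_decreasing) auto
    finally show ?thesis using s by (simp add: field_simps)
  qed
  have geo: "(\<lambda>j. (1/2::real) ^ j / 16 / s) sums (2 / 16 / s)"
    using sums_divide[OF geometric_sums[of "1/2::real"], of "16 * s"] by simp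
  have "(\<Sum>j. bump_deriv (b j) z) - (\<Sum>j<Suc n. bump_deriv (b j) z) = (\<Sum>j. ?k j)"
    using suminf_split_initial_segment[OF summ, of "Suc n"] by simp
  also have "norm \<dots> \<le> (\<Sum>j. (1/2::real) ^ j / 16 / s)"
    by (rule norm_suminf_le[OF le sums_summable[OF geo]])
  also have "\<dots> = 1 / 8 / s" using sums_unique[OF geo] by simp
  finally show ?thesis using s by (simp add: s_def field_simps)
qed

lemma gliding_hump_step:
  fixes n :: nat
  assumes p: "1 \<le> p" and sg: "disc_semigroup \<phi>" and nt: "\<not> trivial_semigroup \<phi>"
    and all: "BMOA p \<subseteq> strong_cont_space \<phi> (BMOA p) (bmoa_norm p)"
    and b: "\<And>j. j < n \<Longrightarrow> norm (b j) < 1" and r: "\<And>j. j < n \<Longrightarrow> r j < 1"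
    and \<epsilon>: "0 < \<epsilon>" and \<tau>: "0 < \<tau>"
  obtains t x s where "0 < t" "t < \<tau>" "norm x < 1" "norm x \<le> s" "norm (\<phi> t x) \<le> s" "s < 1"
    "hyp_prox x (\<phi> t x) \<le> 1/8"
    "\<And>a. a \<in> \<D> \<Longrightarrow> norm ((\<Sum>j<n. bump_deriv (b j) (\<phi> t a)) * deriv (\<phi> t) a -
        (\<Sum>j<n. bump_deriv (b j) a)) * (1 - (norm a)\<^sup>2) \<le> 1/8"
    "\<And>j a. j < n \<Longrightarrow> norm a \<le> r j \<Longrightarrow> interaction a x \<le> \<epsilon>"
    "\<And>a. s \<le> norm a \<Longrightarrow> norm a < 1 \<Longrightarrow> interaction a x \<le> \<epsilon>"
proof -
  let ?g = "\<lambda>z. \<Sum>j<n. bump (b j) z"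
  have dg: "deriv ?g z = (\<Sum>j<n. bump_deriv (b j) z)" if "z \<in> \<D>" for z
    using has_field_derivative_sum_bump[of n b z, OF b that] by (rule DERIV_imp_deriv)
  have g: "?g \<in> strong_cont_space \<phi> (BMOA p) (bmoa_norm p)"
    using all sum_bump_BMOA(1)[of p n b, OF p b] by blast
  have "norm (deriv ?g z) * (1 - (norm z)\<^sup>2) \<le> n" if "z \<in> \<D>" for z
    using sum_bump_BMOA(2)[of p n b z, OF p b that] dg[OF that] by simp
  from strong_cont_space_Bloch_small[OF p sg g this, of "1/8"]
  obtain T where T: "0 < T" "\<And>t a. 0 < t \<Longrightarrow> t < T \<Longrightarrow> a \<in> \<D> \<Longrightarrow>
      norm (deriv ?g (\<phi> t a) * deriv (\<phi> t) a - deriv ?g a) * (1 - (norm a)\<^sup>2) < 1/8" by auto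
  obtain t z0 where t: "0 < t" "t < min T \<tau>" and z0: "z0 \<in> \<D>" "\<phi> t z0 \<noteq> z0"
    using disc_semigroup_nontrivial_small_times[OF sg nt, of "min T \<tau>"] T(1) \<tau> by auto
  have hol: "\<phi> t holomorphic_on \<D>" and im: "\<phi> t ` \<D> \<subseteq> \<D>"
    using sg t by (auto simp: disc_semigroup_def)
  define R where "R = Max (insert 0 (r ` {..<n}))"
  have R: "R < 1" "\<And>j. j < n \<Longrightarrow> r j \<le> R" using r by (auto simp: R_def)
  obtain q where q: "q < 1" "\<And>a b. norm a \<le> R \<Longrightarrow> q \<le> norm b \<Longrightarrow> norm b < 1 \<Longrightarrow> interaction a b \<le> \<epsilon>"
    using interaction_decay[OF R(1) \<epsilon>] by blast
  obtain x where x: "q < norm x" "norm x < 1" "hyp_prox x (\<phi> t x) < 1/8"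
    using non_identity_self_map_moves_far[OF hol im z0 q(1), of "1/8"] by auto
  obtain s where s: "s < 1" "\<And>a b. norm a \<le> norm x \<Longrightarrow> s \<le> norm b \<Longrightarrow> norm b < 1 \<Longrightarrow> interaction a b \<le> \<epsilon>"
    using interaction_decay[OF x(2) \<epsilon>] by blast
  have w: "norm (\<phi> t x) < 1" using im x(2) by (auto simp: image_subset_iff)
  show ?thesis
  proof (rule that[of t x "max s (max (norm x) (norm (\<phi> t x)))"])
    show "norm ((\<Sum>j<n. bump_deriv (b j) (\<phi> t a)) * deriv (\<phi> t) a -
        (\<Sum>j<n. bump_deriv (b j) a)) * (1 - (norm a)\<^sup>2) \<le> 1/8" if a: "a \<in> \<D>" for a
    proof -
      have "\<phi> t a \<in> \<D>" using im a by blast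
      then show ?thesis using T(2)[of t a] t a dg by (simp del: mem_ball_0)
    qed
    show "interaction a x \<le> \<epsilon>" if "j < n" "norm a \<le> r j" for j a
      using R(2)[OF that(1)] that(2) x by (intro q(2)) auto
    show "interaction a x \<le> \<epsilon>" if "max s (max (norm x) (norm (\<phi> t x))) \<le> norm a" "norm a < 1" for a
      using s(2)[of x a] that by (simp add: interaction_commute)
  qed (use t x w s in auto)
qed

lemma gliding_hump_sequence:
  assumes p: "1 \<le> p" and sg: "disc_semigroup \<phi>" and nt: "\<not> trivial_semigroup \<phi>"
    and all: "BMOA p \<subseteq> strong_cont_space \<phi> (BMOA p) (bmoa_norm p)"
  obtains t :: "nat \<Rightarrow> real" and b :: "nat \<Rightarrow> complex" and r :: "nat \<Rightarrow> real" where
    "\<And>n. 0 < t n" "\<And>n. t n < 1 / Suc n" "\<And>n. norm (b n) < 1"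
    "\<And>n. norm (b n) \<le> r n" "\<And>n. norm (\<phi> (t n) (b n)) \<le> r n"
    "\<And>n. hyp_prox (b n) (\<phi> (t n) (b n)) \<le> 1/8"
    "\<And>n a. a \<in> \<D> \<Longrightarrow> norm ((\<Sum>j<n. bump_deriv (b j) (\<phi> (t n) a)) * deriv (\<phi> (t n)) a -
        (\<Sum>j<n. bump_deriv (b j) a)) * (1 - (norm a)\<^sup>2) \<le> 1/8"
    "\<And>j n a. j < n \<Longrightarrow> norm a \<le> r j \<Longrightarrow> interaction a (b n) \<le> (1/2) ^ n / 8"
    "\<And>n a. r n \<le> norm a \<Longrightarrow> norm a < 1 \<Longrightarrow> interaction a (b n) \<le> (1/2) ^ n / 8"
proof -
  define P where "P h n x \<longleftrightarrow> (case x of (t, y, s) \<Rightarrow>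
    0 < t \<and> t < 1 / Suc n \<and> norm y < 1 \<and> norm y \<le> s \<and> norm (\<phi> t y) \<le> s \<and> s < 1 \<and>
    hyp_prox y (\<phi> t y) \<le> 1/8 \<and>
    (\<forall>a\<in>\<D>. norm ((\<Sum>j<n. bump_deriv (fst (snd (h j))) (\<phi> t a)) * deriv (\<phi> t) a -
        (\<Sum>j<n. bump_deriv (fst (snd (h j))) a)) * (1 - (norm a)\<^sup>2) \<le> 1/8) \<and>
    (\<forall>j<n. \<forall>a. norm a \<le> snd (snd (h j)) \<longrightarrow> interaction a y \<le> (1/2) ^ n / 8) \<and>
    (\<forall>a. s \<le> norm a \<longrightarrow> norm a < 1 \<longrightarrow> interaction a y \<le> (1/2) ^ n / 8))"
    for h :: "nat \<Rightarrow> real \<times> complex \<times> real" and n x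
  have "\<exists>h. \<forall>n. P h n (h n)"
  proof (rule dependent_wellorder_choice)
    fix x and f g :: "nat \<Rightarrow> real \<times> complex \<times> real" and n
    assume "\<And>j. j < n \<Longrightarrow> f j = g j"
    then show "P f n x = P g n x" by (simp add: P_def)
  next
    fix n h assume IH: "\<And>j. j < n \<Longrightarrow> P h j (h j)"
    have prev: "norm (fst (snd (h j))) < 1" "snd (snd (h j)) < 1" if "j < n" for j
      using IH[OF that] by (auto simp: P_def split: prod.splits)
    obtain t x s where "0 < t" "t < 1 / Suc n" "norm x < 1" "norm x \<le> s" "norm (\<phi> t x) \<le> s" "s < 1"
      "hyp_prox x (\<phi> t x) \<le> 1/8"
      "\<And>a. a \<in> \<D> \<Longrightarrow> norm ((\<Sum>j<n. bump_deriv (fst (snd (h j))) (\<phi> t a)) * deriv (\<phi> t) a -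
          (\<Sum>j<n. bump_deriv (fst (snd (h j))) a)) * (1 - (norm a)\<^sup>2) \<le> 1/8"
      "\<And>j a. j < n \<Longrightarrow> norm a \<le> snd (snd (h j)) \<Longrightarrow> interaction a x \<le> (1/2) ^ n / 8"
      "\<And>a. s \<le> norm a \<Longrightarrow> norm a < 1 \<Longrightarrow> interaction a x \<le> (1/2) ^ n / 8"
      using gliding_hump_step[OF p sg nt all prev, of n "\<lambda>x. x" "\<lambda>x. x" "(1/2) ^ n / 8" "1 / Suc n"] by auto
    then have "P h n (t, x, s)" by (simp add: P_def)
    then show "\<exists>x. P h n x" by blast
  qed
  then obtain h where h: "\<And>n. P h n (h n)" by blast
  show ?thesis
    by (rule that[of "\<lambda>n. fst (h n)" "\<lambda>n. fst (snd (h n))" "\<lambda>n. snd (snd (h n))"])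
      (use h in \<open>auto simp: P_def case_prod_beta\<close>)
qed

theorem theorem3:
  fixes p :: real and \<phi> :: "real \<Rightarrow> complex \<Rightarrow> complex"
  assumes "1 \<le> p"
    and "disc_semigroup \<phi>"
    and "\<not> trivial_semigroup \<phi>"
  shows "strong_cont_space \<phi> (BMOA p) (bmoa_norm p) \<subset> BMOA p"
proof (rule ccontr)
  note p = assms(1) and sg = assms(2) and nt = assms(3)
  assume "\<not> strong_cont_space \<phi> (BMOA p) (bmoa_norm p) \<subset> BMOA p"
  moreover have "strong_cont_space \<phi> (BMOA p) (bmoa_norm p) \<subseteq> BMOA p"
    by (auto simp: strong_cont_space_def)
  ultimately have all: "BMOA p \<subseteq> strong_cont_space \<phi> (BMOA p) (bmoa_norm p)" by blast
  obtain t :: "nat \<Rightarrow> real" and b :: "nat \<Rightarrow> complex" and r :: "nat \<Rightarrow> real" where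
    t: "\<And>n. 0 < t n" "\<And>n. t n < 1 / Suc n" and b: "\<And>n. norm (b n) < 1"
    and r: "\<And>n. norm (b n) \<le> r n" "\<And>n. norm (\<phi> (t n) (b n)) \<le> r n"
    and far: "\<And>n. hyp_prox (b n) (\<phi> (t n) (b n)) \<le> 1/8"
    and head: "\<And>n a. a \<in> \<D> \<Longrightarrow> norm ((\<Sum>j<n. bump_deriv (b j) (\<phi> (t n) a)) * deriv (\<phi> (t n)) a -
        (\<Sum>j<n. bump_deriv (b j) a)) * (1 - (norm a)\<^sup>2) \<le> 1/8"
    and before: "\<And>j n a. j < n \<Longrightarrow> norm a \<le> r j \<Longrightarrow> interaction a (b n) \<le> (1/2) ^ n / 8"
    and beyond: "\<And>n a. r n \<le> norm a \<Longrightarrow> norm a < 1 \<Longrightarrow> interaction a (b n) \<le> (1/2) ^ n / 8"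
    using gliding_hump_sequence[OF p sg nt all] by blast
  have sum: "summable (\<lambda>n. interaction a (b n))" "(\<Sum>n. interaction a (b n)) \<le> 202" if "a \<in> \<D>" for a
    using gliding_interaction_sum[of b r a, OF b _ beyond that] before by blast+
  obtain f where f: "f \<in> BMOA p" and df: "\<And>z. z \<in> \<D> \<Longrightarrow> (\<lambda>j. bump_deriv (b j) z) sums deriv f z"
    and Bloch: "\<And>z. z \<in> \<D> \<Longrightarrow> norm (deriv f z) * (1 - (norm z)\<^sup>2) \<le> 202"
    using suminf_bump_BMOA[of p b 202, OF p b sum] by blast
  obtain T where T: "0 < T" "\<And>t a. 0 < t \<Longrightarrow> t < T \<Longrightarrow> a \<in> \<D> \<Longrightarrow>
      norm (deriv f (\<phi> t a) * deriv (\<phi> t) a - deriv f a) * (1 - (norm a)\<^sup>2) < 1/2"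
    using strong_cont_space_Bloch_small[OF p sg subsetD[OF all f] Bloch, of "1/2"] by auto
  obtain n where n: "1 / Suc n < T"
    using nat_approx_posE[OF T(1)] by auto
  define a where "a = b n"
  define w where "w = \<phi> (t n) a"
  define D where "D = deriv (\<phi> (t n)) a"
  define s where "s = 1 - (norm a)\<^sup>2"
  define g where "g z = (\<Sum>j<n. bump_deriv (b j) z)" for z
  define k where "k z = bump_deriv a z" for z
  define q where "q z = deriv f z - (\<Sum>j<Suc n. bump_deriv (b j) z)" for z
  have hol: "\<phi> (t n) holomorphic_on \<D>" and im: "\<phi> (t n) ` \<D> \<subseteq> \<D>"
    using sg t(1)[of n] by (auto simp: disc_semigroup_def)
  have a: "a \<in> \<D>" using b by (simp add: a_def)
  have w: "w \<in> \<D>" using im a unfolding w_def by blast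
  have s: "0 < s" using a one_minus_norm_square_bounds(1)[of a] by (simp add: s_def)
  have SP: "norm D * s \<le> 1 - (norm w)\<^sup>2"
    unfolding D_def s_def w_def by (rule Schwarz_Pick_deriv[OF hol im a])
  have split: "deriv f z = g z + k z + q z" for z
    by (simp add: g_def k_def q_def a_def)
  have tail: "norm (q z) * (1 - (norm z)\<^sup>2) \<le> 1/8" if z: "z \<in> \<D>" "norm z \<le> r n" for z
    using gliding_tail_le[of b z n, OF b z(1) sums_summable[OF df[OF z(1)]] before[OF _ z(2)]]
    by (simp add: q_def sums_unique[OF df[OF z(1)]] del: sum.lessThan_Suc)
  have transfer: "norm (y * D) * s \<le> 1/8" if "norm y * (1 - (norm w)\<^sup>2) \<le> 1/8" for y
    using order_trans[OF mult_left_mono[OF SP norm_ge_zero[of y]] that] by (simp add: norm_mult mult.assoc)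
  have 1: "norm (k a) * s = 1"
    using norm_bump_deriv_mult[of a a] a by (simp add: k_def s_def hyp_prox_self)
  have 2: "norm (k w * D) * s \<le> 1/8"
    using norm_bump_deriv_mult[of a w] a w far[of n]
    by (intro transfer) (simp add: k_def w_def a_def)
  have 3: "norm (g w * D - g a) * s \<le> 1/8"
    using head[OF a, of n] by (simp add: g_def D_def w_def s_def)
  have 4: "norm (q w * D) * s \<le> 1/8"
    using tail[OF w] r(2)[of n] by (intro transfer) (simp add: w_def a_def)
  have 5: "norm (q a) * s \<le> 1/8"
    using tail[OF a] r(1)[of n] by (simp add: s_def a_def)
  have tri: "norm (x1 + x2 + x3 - x4 - x5) \<le> norm x1 + norm x2 + norm x3 + norm x4 + norm x5"
    for x1 x2 x3 x4 x5 :: complex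
    by (intro norm_triangle_le_diff norm_triangle_le add_mono order_refl)
  have "k a = k w * D + (g w * D - g a) + q w * D - q a - (deriv f w * D - deriv f a)"
    unfolding split by (simp add: algebra_simps)
  then have "norm (k a) \<le> norm (k w * D) + norm (g w * D - g a) + norm (q w * D) + norm (q a) +
      norm (deriv f w * D - deriv f a)"
    by (simp only: tri)
  from mult_right_mono[OF this, of s] s
  have "1 \<le> 1/8 + 1/8 + 1/8 + 1/8 + norm (deriv f w * D - deriv f a) * s"
    using 1 2 3 4 5 by (simp add: distrib_right)
  moreover have "norm (deriv f w * D - deriv f a) * s < 1/2"
    using T(2)[of "t n" a] t[of n] n a by (simp add: w_def D_def s_def)
  ultimately show False by simp
qed

end
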